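(* Let $h\in L^1(\mathbb{R})$ be a piecewise $C^1$ real-valued function whose Fourier transform can be extended to $\mathbb{C}\setminus(\gamma_{u_1}\cup\dots\cup\gamma_{u_N})$ as $\hat h=Z+H$, where $H$ is an entire function and $Z$ has $N$ algebraic or logarithmic branch points $u_1,\dots,u_N\in\mathbb{C}\setminus\mathbb{R}$ of orders $\rho_1,\dots,\rho_N\in\mathbb{C}\setminus\{0\}$. Suppose also that: (i) $\hat h$ has at most polynomial growth: $|\hat h(u)|\le C(1+|u|^q)$ for some $C,q>0$. (ii) There is $\theta\in(0,\frac{\pi}{2})$ such that $$\sup_{u\in\gamma(R,\theta)}\left(|\hat h(u)|+|\hat h(-u)|\right)\quad\text{and}\quad \sup_{u\in\gamma(-R,\pi-\theta)}\left(|\hat h(u)|+|\hat h(-u)|\right)$$ tend to zero as $R\to+\infty$. (iii) There are $a,b>0$ and $\gamma^+,\gamma^->0$ such that for every $n$: if $\operatorname{Im}(u_n)>0$ then $\operatorname{Im}(u_n)\ge b$, and if $\operatorname{Im}(u_n)=b$ then $\operatorname{Re}(\rho_n)\le\gamma^+$; if $\operatorname{Im}(u_n)<0$ then $\operatorname{Im}(u_n)\le -a$, and if $\operatorname{Im}(u_n)=-a$ then $\operatorname{Re}(\rho_n)\le\gamma^-$. Then there exist constants $C_+,C_->0$ such that $$|I_\infty[\hat h](y)|\le\begin{cases} C_+\,y^{\gamma^+-1}e^{-by}, & y>1,\\ C_-\,|y|^{\gamma^--1}e^{-a|y|}, & y<-1.\end{cases}$$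
   Context: The Fourier transform is $\hat h(z)=\int_{\mathbb{R}}h(y)e^{-\mathrm{i}zy}\,dy$. $I_\infty[\hat h](y):=\frac1{2\pi}\int_{-\infty}^{\infty}\hat h(u)e^{\mathrm{i}uy}\,du$, understood as $\lim_{R\to\infty}\frac1{2\pi}\int_{-R}^{R}\hat h(u)e^{\mathrm{i}uy}\,du$. A property holds piecewise for $h$ if there is a finite partition of $\mathbb{R}$ into intervals on each of which it holds. $\operatorname{sgn}(t)=1$ for $t\ge0$ and $-1$ for $t<0$. For $u_0\in\mathbb{C}$ and $\theta\in(0,\pi)$, $\gamma(u_0,\theta)$ is the half-line $\{u_0+\operatorname{sgn}(\operatorname{Im}u_0)e^{\mathrm{i}\theta}t:\ t>0\}$. The half-line $\gamma_{u_0}:=\gamma(u_0,\frac\pi2)$ is the branch cut starting at the branch point $u_0$. On the plane slit along the cut a branch of $\log(u-u_0)$ is fixed, so that $(u-u_0)^{-\rho}$ is well defined for $\rho\in\mathbb{C}$. A function $Z$ on the plane slit along $\gamma_{u_1},\dots,\gamma_{u_N}$ has algebraic branch points $u_1,\dots,u_N$ of orders $\rho_1,\dots,\rho_N\in\mathbb{C}\setminus\{0\}$ if $Z(u)=g(u)\prod_{n=1}^N(u-u_n)^{-\rho_n}$ with $g$ entire; then $(u-u_n)^{\rho_n}Z(u)$ is analytic in a ball around $u_n$, and $u_n$ is a pole of order $\rho_n$ when $\rho_n\in\mathbb{N}$. If close to some branch point $u_n$ one has instead $Z(u)=(u-u_n)^{-\rho}\log(u-u_n)\,g(u)$ with $-\rho\in\mathbb{N}$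 and $g$ analytic there, the branch point is called logarithmic of order $\rho$. *)

theory Defs
  imports "HOL-Complex_Analysis.Complex_Analysis"
begin

(* One-sided derivatives are used at endpoints that belong to the interval, so h may jump
   between the pieces. This is why the library's piecewise_C1_differentiable_on, which
   demands global continuity, is not used. *)
definition C1_on_interval :: "real set \<Rightarrow> (real \<Rightarrow> real) \<Rightarrow> bool" where
  "C1_on_interval I h \<longleftrightarrow>
     (\<exists>h'. continuous_on I h' \<and> (\<forall>x\<in>I. (h has_real_derivative h' x) (at x within I)))"

definition piecewise_C1 :: "(real \<Rightarrow> real) \<Rightarrow> bool" where
  "piecewise_C1 h \<longleftrightarrow>
     (\<exists>P. finite P \<and> partition_on UNIV P \<and> (\<forall>I\<in>P. is_interval I \<and> C1_on_interval I h))"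

definition fourier :: "(real \<Rightarrow> real) \<Rightarrow> complex \<Rightarrow> complex" where
  "fourier h z = (LINT y|lborel. complex_of_real (h y) * exp (- (\<i> * z * complex_of_real y)))"

definition inv_fourier_trunc :: "(complex \<Rightarrow> complex) \<Rightarrow> real \<Rightarrow> real \<Rightarrow> complex" where
  "inv_fourier_trunc F y R =
     complex_of_real (1 / (2 * pi)) *
     (LINT u:{-R..R}|lborel. F (complex_of_real u) * exp (\<i> * complex_of_real (u * y)))"

(* Only meaningful when the limit exists. *)
definition inv_fourier :: "(complex \<Rightarrow> complex) \<Rightarrow> real \<Rightarrow> complex" where
  "inv_fourier F y = Lim at_top (inv_fourier_trunc F y)"

(* Unlike the library's sgn, this takes the value 1 at 0. *)
definition sgn_ge0 :: "real \<Rightarrow> real" where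
  "sgn_ge0 t = (if t \<ge> 0 then 1 else -1)"

definition half_line :: "complex \<Rightarrow> real \<Rightarrow> complex set" where
  "half_line u0 \<theta> = {u0 + complex_of_real (sgn_ge0 (Im u0)) * cis \<theta> * complex_of_real t | t. t > 0}"

definition branch_cut :: "complex \<Rightarrow> complex set" where
  "branch_cut u0 = half_line u0 (pi / 2)"

(* The half-line does not contain its starting point; the branch points, where the
   functions below are singular, are removed as well. *)
definition slit_plane :: "complex set \<Rightarrow> complex set" where
  "slit_plane U = - (\<Union>u0\<in>U. insert u0 (branch_cut u0))"

definition log_branch :: "complex \<Rightarrow> (complex \<Rightarrow> complex) \<Rightarrow> bool" where
  "log_branch u0 L \<longleftrightarrow>
     L holomorphic_on slit_plane {u0} \<and> (\<forall>z\<in>slit_plane {u0}. exp (L z) = z - u0)"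

(* If L is a branch of log (z - u0), this is (z - u0) to the power s. *)
definition branch_powr :: "(complex \<Rightarrow> complex) \<Rightarrow> complex \<Rightarrow> complex \<Rightarrow> complex" where
  "branch_powr L s z = exp (s * L z)"

(* lg n is the fixed branch of log (z - u n). K is the set of indices of the logarithmic
   points; the others are algebraic. For K = {} the set slit_plane (u ` K) is the whole plane,
   G is entire, and Z = G * (product of the (z - u n) to the power - \<rho> n). The logarithmic
   form is prescribed only near the logarithmic points, so in general the cofactor G of the
   algebraic factors is only required to be holomorphic off the cuts of those points. *)
definition alg_or_log_branch_points ::
    "(complex \<Rightarrow> complex) \<Rightarrow> nat \<Rightarrow> (nat \<Rightarrow> complex) \<Rightarrow> (nat \<Rightarrow> complex) \<Rightarrow> (nat \<Rightarrow> complex \<Rightarrow> complex) \<Rightarrow> bool"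
  where
  "alg_or_log_branch_points Z N u \<rho> lg \<longleftrightarrow>
     (\<exists>K \<subseteq> {1..N}.
        (\<exists>G. G holomorphic_on slit_plane (u ` K) \<and>
             (\<forall>z \<in> slit_plane (u ` {1..N}).
                Z z = G z * (\<Prod>n\<in>{1..N} - K. branch_powr (lg n) (- \<rho> n) z))) \<and>
        (\<forall>n\<in>K. - \<rho> n \<in> \<nat> \<and>
           (\<exists>r>0. \<exists>g. g holomorphic_on ball (u n) r \<and>
              (\<forall>z \<in> ball (u n) r \<inter> slit_plane (u ` {1..N}).
                 Z z = branch_powr (lg n) (- \<rho> n) z * lg n z * g z))))"

end

(* For y > 0 the contour is pushed from the real line into the upper half plane. On far vertical
   lines hypotheses (i) and (ii) together give |F (R + i t)| <= e * exp (t / 2), so these lines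
   disappear as R grows, which also proves that the truncated integrals converge. What remains is
   one integral around each vertical cut. It may always be started at height b, even when the branch
   point lies higher, since |F z| <= C * |z - v| powr (- gamma) near the point v of the cut at
   height b: as gamma > 0, this estimate covers algebraic and logarithmic branch points as well as
   points where F is bounded. Passing v at a distance proportional to 1 / y yields
   y powr (gamma - 1) * exp (- b * y); all parts higher up are exponentially smaller. The case y < 0
   is the same statement for F (- z). *)
theory Submission
  imports Defs
begin

subsection \<open>Contour integrals along segments\<close>

text \<open>All constants must be uniform in y > 1. The rate 1 / 2 in exp (t / 2) could be any
  number below 1: on vertical lines where this growth bound holds, the integrand still decays at
  least like exp (- t / 2), whatever y is. Hypothesis (ii) controls only a wedge at the real axis;
  outside it |z| is bounded by an affine function of the height t, so the polynomial bound (i)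
  becomes a polynomial in t and loses against exp (t / 2). Bound (i) is used for large |z| only; in
  a strip free of cuts compactness covers the rest, with constants depending on the strip, which is
  why the height of the contour tends to infinity before R does. The exponent \<gamma> - 1 arises as
  follows: at distance of order 1 / y from the tip F is of order y powr \<gamma>, and one factor 1 /
  y is gained, either from the length of the segment passing under the tip or from integrating exp
  (- y * t) along the cut. Passing at depth \<delta> / y below the tip costs only the constant
  factor exp \<delta>. All contours are polygons, so Cauchy's theorem for triangles in convex sets
  suffices.\<close>

lemma contour_integral_linepath_triangle:
  assumes "f holomorphic_on S" "convex S" "a \<in> S" "b \<in> S" "c \<in> S"
  shows "contour_integral (linepath a b) f + contour_integral (linepath b c) f
           = contour_integral (linepath a c) f"
proof -
  have hull: "convex hull {a,b,c} \<subseteq> S"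
    using assms by (intro hull_minimal) auto
  have seg: "f contour_integrable_on linepath p q" if "p \<in> S" "q \<in> S" for p q
  proof (rule contour_integrable_continuous_linepath)
    have "closed_segment p q \<subseteq> S"
      using that assms(2) by (simp add: closed_segment_subset)
    then show "continuous_on (closed_segment p q) f"
      using assms(1) holomorphic_on_imp_continuous_on continuous_on_subset by blast
  qed
  have "(f has_contour_integral 0) (linepath a b +++ linepath b c +++ linepath c a)"
    using Cauchy_theorem_triangle holomorphic_on_subset[OF assms(1) hull] by blast
  then have "contour_integral (linepath a b +++ linepath b c +++ linepath c a) f = 0"
    by (rule contour_integral_unique)
  then have "contour_integral (linepath a b) f + (contour_integral (linepath b c) f
      + contour_integral (linepath c a) f) = 0"
    using seg assms(3-5) by simp
  moreover have "contour_integral (linepath c a) f = - contour_integral (linepath a c) f"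
  proof (rule contour_integral_reverse_linepath)
    have "closed_segment c a \<subseteq> S"
      using assms by (simp add: closed_segment_subset)
    then show "continuous_on (closed_segment c a) f"
      using assms(1) holomorphic_on_imp_continuous_on continuous_on_subset by blast
  qed
  ultimately show ?thesis
    by (simp add: algebra_simps)
qed

text \<open>Integrating exp (- c * \<tau>) gains the factor 1 / c, and the bound is free of the
  upper end \<open>t\<close>, so vertical sides may be arbitrarily long.\<close>

lemma contour_integral_vertical_bound:
  assumes cont: "continuous_on (closed_segment (Complex p s) (Complex p t)) f"
    and "s \<le> t" "c > 0" "B \<ge> 0"
    and bound: "\<And>\<tau>. s \<le> \<tau> \<Longrightarrow> \<tau> \<le> t \<Longrightarrow> norm (f (Complex p \<tau>)) \<le> B * exp (- c * \<tau>)"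
  shows "norm (contour_integral (linepath (Complex p s) (Complex p t)) f) \<le> B * exp (- c * s) / c"
proof (cases "s < t")
  case True
  let ?I = "contour_integral (linepath (Complex p s) (Complex p t)) f"
  have "(f has_contour_integral ?I) (linepath (Complex p s) (Complex p t))"
    using contour_integrable_continuous_linepath[OF cont] by (rule has_contour_integral_integral)
  then have I: "((\<lambda>\<tau>. f (Complex p \<tau>)) has_integral (- \<i> * ?I)) {s..t}"
    using has_contour_integral_linepath_same_Re_iff[of _ p _ s t] True by simp
  have E: "((\<lambda>\<tau>. B * exp (- c * \<tau>)) has_integral
      (- B * exp (- c * t) / c - (- B * exp (- c * s) / c))) {s..t}"
  proof (rule fundamental_theorem_of_calculus[OF \<open>s \<le> t\<close>])
    fix x
    show "((\<lambda>\<tau>. - B * exp (- c * \<tau>) / c) has_vector_derivative B * exp (- c * x)) (at x within {s..t})"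
      unfolding has_real_derivative_iff_has_vector_derivative[symmetric]
      using \<open>c > 0\<close> by (auto intro!: derivative_eq_intros)
  qed
  have "norm (- \<i> * ?I) \<le> - B * exp (- c * t) / c - (- B * exp (- c * s) / c)"
    unfolding integral_unique[OF I, symmetric] integral_unique[OF E, symmetric]
    using I E bound by (intro integral_norm_bound_integral) auto
  moreover have "- B * exp (- c * t) / c \<le> 0"
    using assms by (simp add: divide_nonpos_pos)
  ultimately show ?thesis
    by (simp add: norm_mult)
next
  case False
  then have "s = t" using assms by simp
  then show ?thesis using assms by simp
qed

text \<open>For y > 1 one has y powr (1 - \<gamma>) \<le> y \<le> exp (d * y) / d. Since \<gamma> -
  1 may be negative, exp (- b * y) alone need not fit under the target bound; a surplus decay exp (-
  d * y) does.\<close>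

lemma exp_le_powr_times_exp:
  fixes y :: real
  assumes "y > 1" "\<gamma> > 0" "d > 0"
  shows "exp (- (b + d) * y) \<le> 1 / d * (y powr (\<gamma> - 1) * exp (- b * y))"
proof -
  have "y powr (1 - \<gamma>) \<le> y powr 1"
    using assms by (intro powr_mono) auto
  also have "\<dots> \<le> exp (d * y) / d"
  proof -
    have "d * y \<le> exp (d * y)"
      using exp_ge_add_one_self[of "d * y"] by linarith
    then show ?thesis
      using assms by (simp add: field_simps)
  qed
  finally have "y powr (1 - \<gamma>) * exp (- d * y) * d \<le> 1"
    using assms by (simp add: exp_minus field_simps)
  then have "y powr (\<gamma> - 1) * (y powr (1 - \<gamma>) * exp (- d * y) * d) \<le> y powr (\<gamma> - 1) * 1"
    by (intro mult_left_mono) auto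
  moreover have "y powr (\<gamma> - 1) * y powr (1 - \<gamma>) = 1"
    using assms by (simp flip: powr_add)
  ultimately have "exp (- d * y) * d \<le> y powr (\<gamma> - 1)"
    by (metis (no_types, lifting) mult.assoc mult.commute mult_1 mult.right_neutral)
  then have "exp (- d * y) * exp (- b * y) \<le> 1 / d * y powr (\<gamma> - 1) * exp (- b * y)"
    using assms by (intro mult_right_mono) (auto simp: field_simps)
  then show ?thesis
    by (simp add: algebra_simps flip: exp_add)
qed

lemma closed_segment_Complex_horizontal:
  assumes "p \<le> q"
  shows "closed_segment (Complex p t) (Complex q t) = {z. p \<le> Re z \<and> Re z \<le> q \<and> Im z = t}"
  using closed_segment_same_Im[of "Complex p t" "Complex q t"] assms
  by (auto simp: closed_segment_eq_real_ivl)

lemma closed_segment_Complex_vertical: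
  assumes "s \<le> t"
  shows "closed_segment (Complex p s) (Complex p t) = {z. s \<le> Im z \<and> Im z \<le> t \<and> Re z = p}"
  using closed_segment_same_Re[of "Complex p s" "Complex p t"] assms
  by (auto simp: closed_segment_eq_real_ivl)

text \<open>Serves to let the height T of a contour tend to infinity; \<open>B\<close> may depend on
  everything except T.\<close>

lemma le_of_exp_vanishing:
  fixes k u v B T0 :: real
  assumes "k > 0" "\<And>T. T \<ge> T0 \<Longrightarrow> u \<le> v + B * exp (- T * k)"
  shows "u \<le> v"
proof (rule tendsto_lowerbound)
  show "((\<lambda>T. v + B * exp (- T * k)) \<longlongrightarrow> v) at_top"
    using assms(1) by real_asymp
  show "\<forall>\<^sub>F T in at_top. u \<le> v + B * exp (- T * k)"
    using eventually_ge_at_top[of T0] by eventually_elim (use assms(2) in auto)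
qed auto

lemma convergent_at_top_Cauchy:
  fixes g :: "real \<Rightarrow> 'a::complete_space"
  assumes "\<And>e. e > 0 \<Longrightarrow> \<exists>R0. \<forall>R\<ge>R0. \<forall>S\<ge>R0. dist (g R) (g S) < e"
  shows "\<exists>L. (g \<longlongrightarrow> L) at_top"
proof -
  have "cauchy_filter (filtermap g at_top)"
    unfolding cauchy_filter_metric_filtermap
  proof (intro allI impI)
    fix e :: real assume "e > 0"
    then obtain R0 where R0: "\<forall>R\<ge>R0. \<forall>S\<ge>R0. dist (g R) (g S) < e"
      using assms by blast
    then show "\<exists>P. eventually P at_top \<and> (\<forall>x y. P x \<and> P y \<longrightarrow> dist (g x) (g y) < e)"
      by (intro exI[of _ "\<lambda>R. R \<ge> R0"]) (auto simp: eventually_ge_at_top)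
  qed
  moreover have "filtermap g at_top \<noteq> bot"
    by (simp add: filtermap_bot_iff)
  ultimately obtain L where "filtermap g at_top \<le> nhds L"
    using complete_UNIV[where 'a='a] unfolding complete_uniform by auto
  then show ?thesis
    by (auto simp: filterlim_def)
qed

subsection \<open>Fourier integrals in a half plane with vertical cuts\<close>

text \<open>What the contour argument retains of the branch points. \<open>X\<close> holds the
  abscissae of the cuts in the half plane considered; branch points on one vertical line share an
  element of \<open>X\<close>, and their cuts are replaced by a single one with tip
  \<open>Complex x b\<close>. \<open>growth\<close> speaks of large modulus only, since F may blow
  up at the tips. The margin \<open>a\<close> makes the real axis interior to the domain.\<close>

locale slit_half_plane =
  fixes F :: "complex \<Rightarrow> complex" and X :: "real set" and a b \<gamma> :: real
  assumes finite_X: "finite X"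
    and a_pos: "a > 0" and b_pos: "b > 0" and \<gamma>_pos: "\<gamma> > 0"
    and holo: "F holomorphic_on {z. - a < Im z \<and> (Re z \<in> X \<longrightarrow> Im z < b)}"
    and local_bound: "\<And>x. x \<in> X \<Longrightarrow>
      \<exists>C r. r > 0 \<and> (\<forall>z. norm (z - Complex x b) < r \<longrightarrow> (Re z \<in> X \<longrightarrow> Im z < b) \<longrightarrow>
         norm (F z) \<le> C * norm (z - Complex x b) powr (- \<gamma>))"
    and growth: "\<exists>C M q. q > 0 \<and>
      (\<forall>z. Im z \<ge> 0 \<longrightarrow> Re z \<notin> X \<longrightarrow> norm z \<ge> M \<longrightarrow> norm (F z) \<le> C * (1 + norm z powr q))"
    and wedge: "\<exists>\<kappa>>0. \<forall>e>0. \<exists>R0. \<forall>z. Im z > 0 \<longrightarrow> \<bar>Re z\<bar> \<ge> R0 + \<kappa> * Im z \<longrightarrow> norm (F z) \<le> e"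
begin

definition D :: "complex set" where
  "D = {z. - a < Im z \<and> (Re z \<in> X \<longrightarrow> Im z < b)}"

definition f :: "real \<Rightarrow> complex \<Rightarrow> complex" where
  "f y z = F z * exp (\<i> * z * of_real y)"

abbreviation J :: "real \<Rightarrow> complex \<Rightarrow> complex \<Rightarrow> complex" where
  "J y z w \<equiv> contour_integral (linepath z w) (f y)"

text \<open>\<open>\<Delta> y T p q\<close> is what the cuts between \<open>p\<close> and \<open>q\<close> contribute to the integral over \<open>[p, q]\<close>
  when the contour is pushed up to height \<open>T\<close>. It is additive in \<open>[p, q]\<close>, which allows the cuts to
  be treated one at a time.\<close>

definition \<Delta> :: "real \<Rightarrow> real \<Rightarrow> real \<Rightarrow> real \<Rightarrow> complex" where
  "\<Delta> y T p q = J y (Complex p 0) (Complex q 0) - J y (Complex p 0) (Complex p T)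
      + J y (Complex q 0) (Complex q T)"

section \<open>Estimates and Cauchy's theorem on single segments\<close>

lemma f_holo: "f y holomorphic_on D"
  unfolding f_def[abs_def] using holo by (auto intro!: holomorphic_intros simp: D_def)

lemma norm_f: "norm (f y z) = norm (F z) * exp (- y * Im z)"
  by (simp add: f_def norm_mult algebra_simps)

lemma J_triangle:
  assumes "convex S" "S \<subseteq> D" "u \<in> S" "v \<in> S" "w \<in> S"
  shows "J y u v + J y v w = J y u w"
  using contour_integral_linepath_triangle[OF holomorphic_on_subset[OF f_holo assms(2)] assms(1,3-5)] .

lemma J_bound:
  assumes "closed_segment u v \<subseteq> D" "B \<ge> 0" "\<And>z. z \<in> closed_segment u v \<Longrightarrow> norm (f y z) \<le> B"
  shows "norm (J y u v) \<le> B * norm (v - u)"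
  using assms continuous_on_subset[OF holomorphic_on_imp_continuous_on[OF f_holo] assms(1)]
  by (intro contour_integral_bound_linepath contour_integrable_continuous_linepath) auto

lemma horizontal_bound:
  assumes "p \<le> q" "\<And>z. p \<le> Re z \<Longrightarrow> Re z \<le> q \<Longrightarrow> Im z = t \<Longrightarrow> z \<in> D \<and> norm (F z) \<le> B"
  shows "norm (J y (Complex p t) (Complex q t)) \<le> B * exp (- t * y) * (q - p)"
proof -
  have "norm (F (Complex p t)) \<le> B"
    using assms by auto
  then have "B \<ge> 0"
    by (meson norm_ge_zero order_trans)
  then have "norm (J y (Complex p t) (Complex q t)) \<le> B * exp (- t * y) * norm (Complex q t - Complex p t)"
    using assms by (intro J_bound)
      (auto simp: closed_segment_Complex_horizontal norm_f algebra_simps intro!: mult_mono)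
  also have "Complex q t - Complex p t = of_real (q - p)"
    by (simp add: complex_eq_iff)
  finally show ?thesis
    using assms(1) by (simp only: norm_of_real)
qed

text \<open>The rate \<open>k\<close> is 0 beside a cut near its tip, where F is bounded on the
  segment, and 1 / 2 on lines where only the growth bound exp (t / 2) is available.\<close>

lemma vertical_bound:
  assumes "s \<le> t" "y > k" "B \<ge> 0" "- a < s" "p \<in> X \<Longrightarrow> t < b"
    and "\<And>\<tau>. s \<le> \<tau> \<Longrightarrow> \<tau> \<le> t \<Longrightarrow> norm (F (Complex p \<tau>)) \<le> B * exp (k * \<tau>)"
  shows "norm (J y (Complex p s) (Complex p t)) \<le> B * exp (- (y - k) * s) / (y - k)"
proof (rule contour_integral_vertical_bound)
  have "closed_segment (Complex p s) (Complex p t) \<subseteq> D"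
    unfolding closed_segment_Complex_vertical[OF assms(1)] using assms by (auto simp: D_def)
  then show "continuous_on (closed_segment (Complex p s) (Complex p t)) (f y)"
    using continuous_on_subset holomorphic_on_imp_continuous_on f_holo by blast
  fix \<tau> assume "s \<le> \<tau>" "\<tau> \<le> t"
  then have "norm (F (Complex p \<tau>)) * exp (- y * \<tau>) \<le> B * exp (k * \<tau>) * exp (- y * \<tau>)"
    using assms by (intro mult_right_mono) auto
  then show "norm (f y (Complex p \<tau>)) \<le> B * exp (- (y - k) * \<tau>)"
    by (simp add: norm_f algebra_simps flip: exp_add)
qed (use assms in auto)

text \<open>Up to a certain height the strip is compact and F is continuous on it; above that height
  |z| exceeds \<open>M\<close> and is at most \<open>m + Im z\<close>, so polynomial growth in |z|
  is beaten by exp (Im z / 2).\<close>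

lemma strip_growth:
  assumes "X \<inter> {p..q} = {}"
  shows "\<exists>B\<ge>0. \<forall>z. p \<le> Re z \<longrightarrow> Re z \<le> q \<longrightarrow> Im z \<ge> 0 \<longrightarrow> norm (F z) \<le> B * exp (Im z / 2)"
proof -
  obtain C M e where e: "e > 0" and
    C: "\<And>z. Im z \<ge> 0 \<Longrightarrow> Re z \<notin> X \<Longrightarrow> norm z \<ge> M \<Longrightarrow> norm (F z) \<le> C * (1 + norm z powr e)"
    using growth by blast
  define m where "m = max \<bar>p\<bar> \<bar>q\<bar>"
  have "((\<lambda>t. (1 + (m + t) powr e) * exp (- (t / 2))) \<longlongrightarrow> 0) at_top"
    using e by real_asymp
  then have "\<forall>\<^sub>F t in at_top. (1 + (m + t) powr e) * exp (- (t / 2)) < 1"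
    by (rule order_tendstoD) simp
  then obtain T1 where T1: "\<And>t. t \<ge> T1 \<Longrightarrow> (1 + (m + t) powr e) * exp (- (t / 2)) < 1"
    unfolding eventually_at_top_linorder by blast
  define T where "T = max T1 (max M 0)"
  have "compact (cbox (Complex p 0) (Complex q T))"
    by (rule compact_cbox)
  moreover have "cbox (Complex p 0) (Complex q T) \<subseteq> D"
    using assms a_pos by (auto simp: cbox_complex_eq D_def in_cbox_complex_iff)
  then have "continuous_on (cbox (Complex p 0) (Complex q T)) F"
    using holo unfolding D_def[symmetric]
    by (meson continuous_on_subset holomorphic_on_imp_continuous_on)
  ultimately have "bounded (F ` cbox (Complex p 0) (Complex q T))"
    by (intro compact_imp_bounded compact_continuous_image)
  then obtain B0 where B0: "\<And>z. z \<in> cbox (Complex p 0) (Complex q T) \<Longrightarrow> norm (F z) \<le> B0"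
    by (auto simp: bounded_iff)
  define B where "B = max 0 (max B0 C)"
  have "norm (F z) \<le> B * exp (Im z / 2)" if z: "p \<le> Re z" "Re z \<le> q" "Im z \<ge> 0" for z
  proof (cases "Im z \<le> T")
    case True
    then have "norm (F z) \<le> B"
      using B0[of z] z by (auto simp: in_cbox_complex_iff B_def)
    also have "\<dots> \<le> B * exp (Im z / 2)"
      using z by (intro mult_right_mono[of 1 "exp (Im z / 2)" B, simplified mult.commute mult_1] mult_le_cancel_left1[THEN iffD2]) (auto simp: B_def)
    finally show ?thesis .
  next
    case False
    have "norm z \<ge> M"
      using False abs_Im_le_cmod[of z] by (auto simp: T_def)
    moreover have "Re z \<notin> X"
      using assms z by auto
    ultimately have "norm (F z) \<le> C * (1 + norm z powr e)"
      using C z by blast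
    also have "\<dots> \<le> B * (1 + norm z powr e)"
      by (intro mult_right_mono) (auto simp: B_def intro!: add_nonneg_nonneg)
    also have "norm z \<le> m + Im z"
      using cmod_le[of z] z by (auto simp: m_def)
    then have "B * (1 + norm z powr e) \<le> B * (1 + (m + Im z) powr e)"
      using e by (intro mult_left_mono add_left_mono powr_mono2) (auto simp: B_def)
    also have "\<dots> \<le> B * exp (Im z / 2)"
    proof (rule mult_left_mono)
      have "(1 + (m + Im z) powr e) * exp (- (Im z / 2)) < 1"
        using T1[of "Im z"] False by (simp add: T_def)
      then show "1 + (m + Im z) powr e \<le> exp (Im z / 2)"
        by (simp add: exp_minus field_simps)
    qed (simp add: B_def)
    finally show ?thesis .
  qed
  moreover have "B \<ge> 0" by (simp add: B_def)
  ultimately show ?thesis by blast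
qed

lemma convex_box: "convex {z. p \<le> Re z \<and> Re z \<le> q \<and> - a < Im z}"
proof -
  have "{z. p \<le> Re z \<and> Re z \<le> q \<and> - a < Im z} = {z. Re z \<ge> p} \<inter> ({z. Re z \<le> q} \<inter> {z. Im z > - a})"
    by auto
  then show ?thesis
    by (simp add: convex_Int convex_halfspace_Re_ge convex_halfspace_Re_le convex_halfspace_Im_gt)
qed

text \<open>One of the two kinds of convex sets on which contours are deformed: a vertical strip
  between neighbouring cuts. The other, in \<open>J_triangle_bottom\<close>, is the horizontal strip
  below all tips, where a contour may pass underneath the cuts.\<close>

lemma J_triangle_strip:
  assumes "X \<inter> {p..q} = {}" "p \<le> Re u" "Re u \<le> q" "p \<le> Re v" "Re v \<le> q" "p \<le> Re w" "Re w \<le> q"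
    and "- a < Im u" "- a < Im v" "- a < Im w"
  shows "J y u v + J y v w = J y u w"
  by (rule J_triangle[OF convex_box[of p q]]) (use assms in \<open>auto simp: D_def\<close>)

lemma J_triangle_bottom:
  assumes "- a < Im u" "- a < Im v" "- a < Im w" "Im u < b" "Im v < b" "Im w < b"
  shows "J y u v + J y v w = J y u w"
proof (rule J_triangle)
  have "{z. - a < Im z \<and> Im z < b} = {z. Im z > - a} \<inter> {z. Im z < b}"
    by auto
  then show "convex {z. - a < Im z \<and> Im z < b}"
    by (simp add: convex_Int convex_halfspace_Im_gt convex_halfspace_Im_lt)
qed (use assms in \<open>auto simp: D_def\<close>)

text \<open>The integrals over the vertical line at \<open>q\<close> cancel formally, even if this
  line runs into a cut; what remains lies on the real axis.\<close>

lemma \<Delta>_add: "\<Delta> y T p q + \<Delta> y T q r = \<Delta> y T p r"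
  unfolding \<Delta>_def
  using J_triangle_bottom[of "Complex p 0" "Complex q 0" "Complex r 0" y] a_pos b_pos
  by (simp add: algebra_simps)

text \<open>Cauchy's theorem on a rectangle, divided by the diagonal from \<open>Complex p 0\<close>
  to \<open>Complex q T\<close>.\<close>

lemma \<Delta>_gap:
  assumes "X \<inter> {p..q} = {}" "p \<le> q" "T \<ge> 0"
  shows "\<Delta> y T p q = J y (Complex p T) (Complex q T)"
  unfolding \<Delta>_def
  using J_triangle_strip[OF assms(1), of "Complex p 0" "Complex q 0" "Complex q T" y]
    J_triangle_strip[OF assms(1), of "Complex p 0" "Complex p T" "Complex q T" y] a_pos assms(2,3)
  by (simp add: algebra_simps)

lemma gap_bound:
  assumes "X \<inter> {p..q} = {}" "p \<le> q"
  shows "\<exists>B\<ge>0. \<forall>y T. T \<ge> 0 \<longrightarrow> norm (J y (Complex p T) (Complex q T)) \<le> B * exp (- T * (y - 1 / 2))"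
proof -
  obtain B where B: "B \<ge> 0" "\<And>z. p \<le> Re z \<Longrightarrow> Re z \<le> q \<Longrightarrow> Im z \<ge> 0 \<Longrightarrow> norm (F z) \<le> B * exp (Im z / 2)"
    using strip_growth[OF assms(1)] by blast
  have "norm (J y (Complex p T) (Complex q T)) \<le> B * (q - p) * exp (- T * (y - 1 / 2))" if "T \<ge> 0" for y T
  proof -
    have "norm (J y (Complex p T) (Complex q T)) \<le> B * exp (T / 2) * exp (- T * y) * (q - p)"
      using B that assms a_pos by (intro horizontal_bound) (auto simp: D_def)
    then show ?thesis
      by (simp add: algebra_simps flip: exp_add)
  qed
  then show ?thesis
    using B(1) assms(2) by (intro exI[of _ "B * (q - p)"]) auto
qed

section \<open>Contribution of the cuts between two abscissae\<close>

definition decaying :: "real \<Rightarrow> real \<Rightarrow> bool" where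
  "decaying p q \<longleftrightarrow> (\<exists>K T0. \<forall>y>1. \<forall>T\<ge>T0. norm (\<Delta> y T p q) \<le> K * (y powr (\<gamma> - 1) * exp (- b * y)))"

lemma decaying_trans:
  assumes "decaying p q" "decaying q r"
  shows "decaying p r"
proof -
  obtain K T where 1: "\<And>y T'. y > 1 \<Longrightarrow> T' \<ge> T \<Longrightarrow> norm (\<Delta> y T' p q) \<le> K * (y powr (\<gamma> - 1) * exp (- b * y))"
    using assms(1) unfolding decaying_def by blast
  obtain L S where 2: "\<And>y T'. y > 1 \<Longrightarrow> T' \<ge> S \<Longrightarrow> norm (\<Delta> y T' q r) \<le> L * (y powr (\<gamma> - 1) * exp (- b * y))"
    using assms(2) unfolding decaying_def by blast
  have "norm (\<Delta> y T' p r) \<le> (K + L) * (y powr (\<gamma> - 1) * exp (- b * y))"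
    if "y > 1" "T' \<ge> max T S" for y T'
    unfolding \<Delta>_add[of y T' p q r, symmetric] distrib_right
    using that by (intro norm_triangle_mono 1 2) auto
  then show ?thesis
    unfolding decaying_def by blast
qed

lemma decaying_gap:
  assumes "X \<inter> {p..q} = {}" "p \<le> q"
  shows "decaying p q"
proof -
  obtain B where B: "B \<ge> 0" "\<And>y T. T \<ge> 0 \<Longrightarrow> norm (J y (Complex p T) (Complex q T)) \<le> B * exp (- T * (y - 1 / 2))"
    using gap_bound[OF assms] by blast
  \<comment> \<open>For y > 1 this lower bound on T gives T * (y - 1 / 2) \<ge> T / 2 * y \<ge> (b +
    1) * y, one unit of decay more than the target.\<close>
  have "norm (\<Delta> y T p q) \<le> B * (y powr (\<gamma> - 1) * exp (- b * y))" if "y > 1" "T \<ge> 2 * b + 2" for y T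
  proof -
    have "norm (\<Delta> y T p q) \<le> B * exp (- T * (y - 1 / 2))"
      using \<Delta>_gap[OF assms] B that b_pos by auto
    also have "\<dots> \<le> B * exp (- (b + 1) * y)"
    proof -
      have "(b + 1) * y \<le> T / 2 * y"
        using that by (intro mult_right_mono) auto
      also have "\<dots> \<le> T * (y - 1 / 2)"
      proof -
        have "0 \<le> T / 2 * (y - 1)"
          using that b_pos by (intro mult_nonneg_nonneg) auto
        then show ?thesis
          by (simp add: field_simps)
      qed
      finally have "- T * (y - 1 / 2) \<le> - (b + 1) * y"
        by (simp add: algebra_simps)
      then show ?thesis
        using B(1) by (intro mult_left_mono) auto
    qed
    also have "\<dots> \<le> B * (1 / 1 * (y powr (\<gamma> - 1) * exp (- b * y)))"
      using that \<gamma>_pos B(1) by (intro mult_left_mono exp_le_powr_times_exp) auto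
    finally show ?thesis by simp
  qed
  then show ?thesis
    unfolding decaying_def by blast
qed

text \<open>The freedom in \<open>d\<close> makes the column fit strictly inside any interval around
  \<open>x\<close>, and it contains no other cut; both are what the splitting in
  \<open>decaying_interval\<close> relies on.\<close>

lemma decaying_column:
  assumes x: "x \<in> X" and d: "d > 0"
  shows "\<exists>\<delta>. 0 < \<delta> \<and> \<delta> < d \<and> X \<inter> {x-\<delta>..x+\<delta>} = {x} \<and> decaying (x - \<delta>) (x + \<delta>)"
proof -
  obtain C0 r where r: "r > 0" and C0: "\<And>z. norm (z - Complex x b) < r \<Longrightarrow> (Re z \<in> X \<longrightarrow> Im z < b) \<Longrightarrow>
         norm (F z) \<le> C0 * norm (z - Complex x b) powr (- \<gamma>)"
    using local_bound[OF x] by blast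
  obtain \<epsilon> where \<epsilon>: "\<epsilon> > 0" "\<And>x'. x' \<in> X \<Longrightarrow> x' \<noteq> x \<Longrightarrow> \<epsilon> \<le> dist x x'"
    using finite_set_avoid[OF finite_X, of x] by blast
  text \<open>The contour passes the tip of the cut at distance \<open>\<eta> = \<delta> / y\<close>, follows the cut on both sides
    up to the fixed height \<open>b + \<delta>\<close>, and from there on keeps the fixed distance \<open>\<delta>\<close>, because
    nothing is known about \<open>F\<close> next to the cut further up.\<close>
  define \<delta> where "\<delta> = min (r / 3) (min (d / 2) (min (b / 2) (\<epsilon> / 2)))"
  \<comment> \<open>The square of half side \<delta> around the tip lies in the disc of radius r,
    because |Re| + |Im| \<le> 2 * \<delta> < r there; \<delta> < b keeps the contour above the real
    axis, and \<delta> < \<epsilon> keeps the other cuts out of the column.\<close>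
  have \<delta>: "\<delta> > 0" "3 * \<delta> \<le> r" "\<delta> < d" "\<delta> < b" "\<delta> < \<epsilon>"
    unfolding \<delta>_def using r d b_pos \<epsilon>(1) by (auto simp: min_def)
  have only: "x' = x" if "x' \<in> X" "\<bar>x' - x\<bar> \<le> \<delta>" for x'
    using \<epsilon>(2)[OF that(1)] that(2) \<delta>(5) by (force simp: dist_real_def)
  define C where "C = max C0 0"
  have C: "C \<ge> 0" by (simp add: C_def)
  have near: "norm (F z) \<le> C * e powr (- \<gamma>)"
    if "\<bar>Re z - x\<bar> \<le> \<delta>" "\<bar>Im z - b\<bar> \<le> \<delta>" "Re z \<in> X \<longrightarrow> Im z < b"
      "e > 0" "e \<le> \<bar>Re z - x\<bar> \<or> e \<le> \<bar>Im z - b\<bar>" for z e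
  proof -
    have "norm (z - Complex x b) < r"
      using cmod_le[of "z - Complex x b"] that(1,2) \<delta>(1,2) by simp
    then have "norm (F z) \<le> C0 * norm (z - Complex x b) powr (- \<gamma>)"
      using C0 that(3) by blast
    also have "\<dots> \<le> C * norm (z - Complex x b) powr (- \<gamma>)"
      by (intro mult_right_mono) (auto simp: C_def)
    also have "\<dots> \<le> C * e powr (- \<gamma>)"
    proof (intro mult_left_mono C powr_mono2')
      show "e \<le> norm (z - Complex x b)"
        using that(5) abs_Re_le_cmod[of "z - Complex x b"] abs_Im_le_cmod[of "z - Complex x b"] by auto
    qed (use that \<gamma>_pos in auto)
    finally show ?thesis .
  qed
  define P Q \<tau> where "P = x - \<delta>" and "Q = x + \<delta>" and "\<tau> = b + \<delta>"
  have "X \<inter> {P..P} = {}" "X \<inter> {Q..Q} = {}"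
    using only[of P] only[of Q] \<delta>(1) by (auto simp: P_def Q_def)
  then obtain BP BQ where
    BP: "BP \<ge> 0" "\<And>t. t \<ge> 0 \<Longrightarrow> norm (F (Complex P t)) \<le> BP * exp (t / 2)" and
    BQ: "BQ \<ge> 0" "\<And>t. t \<ge> 0 \<Longrightarrow> norm (F (Complex Q t)) \<le> BQ * exp (t / 2)"
    using strip_growth[of P P] strip_growth[of Q Q]
    by (metis complex.sel order_refl)
  \<comment> \<open>\<open>A\<close> belongs to the segments at distance \<eta> from the tip, the
    factor exp \<delta> being the price of starting at height b - \<eta>; \<open>A'\<close> belongs
    to those at height \<open>\<tau>\<close>. The summands of \<open>K\<close> are, in this order,
    the segment under the tip, the two at height \<open>\<tau>\<close>, the two sides of the cut and
    the two vertical tails.\<close>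
  define A where "A = C * \<delta> powr (- \<gamma>) * exp \<delta>"
  define A' where "A' = C * \<delta> powr (- \<gamma>)"
  define K where "K = 2 * \<delta> * A + A' + A' + A + A + 2 * BP * exp (\<tau> / 2) / \<delta> + 2 * BQ * exp (\<tau> / 2) / \<delta>"
  have "norm (\<Delta> y T P Q) \<le> K * (y powr (\<gamma> - 1) * exp (- b * y))" if y: "y > 1" and T: "T \<ge> \<tau>" for y T
  proof -
    define E where "E = y powr (\<gamma> - 1) * exp (- b * y)"
    have E: "E \<ge> 0" by (simp add: E_def)
    define \<eta> where "\<eta> = \<delta> / y"
    have \<eta>: "0 < \<eta>" "\<eta> < \<delta>" "\<eta> * y = \<delta>"
      using \<delta>(1) y by (auto simp: \<eta>_def field_simps)
    define \<beta> l r where "\<beta> = b - \<eta>" and "l = x - \<eta>" and "r = x + \<eta>"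
    have l: "X \<inter> {P..l} = {}" and r: "X \<inter> {r..Q} = {}"
      using only \<eta> by (force simp: P_def Q_def l_def r_def)+
    have ord: "0 < \<beta>" "\<beta> < b" "b < \<tau>" "P < l" "l < x" "x < r" "r < Q" "\<beta> < \<tau>"
      using \<eta> \<delta> by (auto simp: \<beta>_def \<tau>_def P_def Q_def l_def r_def)
    \<comment> \<open>Here y powr \<gamma> is split as y * y powr (\<gamma> - 1). The surplus factor
      y is used up by the length 2 * \<delta> / y in \<open>b1\<close> and by the division by y in
      \<open>side\<close>.\<close>
    have pow: "\<eta> powr (- \<gamma>) * exp (- \<beta> * y) = \<delta> powr (- \<gamma>) * exp \<delta> * (y * E)"
    proof -
      have "\<eta> powr (- \<gamma>) = \<delta> powr (- \<gamma>) * y powr \<gamma>"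
        using \<delta>(1) y by (simp add: \<eta>_def powr_divide powr_minus divide_simps)
      moreover have "exp (- \<beta> * y) = exp \<delta> * exp (- b * y)"
        using \<eta>(3) by (simp add: \<beta>_def algebra_simps flip: exp_add)
      moreover have "y powr \<gamma> = y * y powr (\<gamma> - 1)"
        using y by (simp add: powr_diff)
      ultimately show ?thesis
        by (simp add: E_def)
    qed
    let ?J = "\<lambda>p s q t. J y (Complex p s) (Complex q t)"
    note bot = J_triangle_bottom[of "Complex _ _" "Complex _ _" "Complex _ _" y, simplified]
    note left = J_triangle_strip[OF l, of "Complex _ _" "Complex _ _" "Complex _ _" y, simplified]
    note right = J_triangle_strip[OF r, of "Complex _ _" "Complex _ _" "Complex _ _" y, simplified]
    \<comment> \<open>Cauchy's theorem triangle by triangle, with collinear triples merely splitting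
      a segment: \<open>i1\<close> below all tips, \<open>i2\<close> left of the cut,
      \<open>i3\<close> right of it. Eliminating the auxiliary segments by linear algebra leaves the
      contour in \<open>\<Delta>_eq\<close>.\<close>
    have i1: "?J P 0 Q 0 + ?J Q 0 Q \<beta> = ?J P 0 Q \<beta>" "?J P 0 P \<beta> + ?J P \<beta> Q \<beta> = ?J P 0 Q \<beta>"
      "?J P \<beta> l \<beta> + ?J l \<beta> Q \<beta> = ?J P \<beta> Q \<beta>" "?J l \<beta> r \<beta> + ?J r \<beta> Q \<beta> = ?J l \<beta> Q \<beta>"
      using ord a_pos by (auto intro!: bot)
    have i2: "?J P \<beta> l \<beta> + ?J l \<beta> l \<tau> = ?J P \<beta> l \<tau>" "?J P \<beta> P \<tau> + ?J P \<tau> l \<tau> = ?J P \<beta> l \<tau>"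
      "?J P 0 P \<beta> + ?J P \<beta> P \<tau> = ?J P 0 P \<tau>" "?J P 0 P \<tau> + ?J P \<tau> P T = ?J P 0 P T"
      using ord a_pos T by (auto intro!: left)
    have i3: "?J r \<beta> Q \<beta> + ?J Q \<beta> Q \<tau> = ?J r \<beta> Q \<tau>" "?J r \<beta> r \<tau> + ?J r \<tau> Q \<tau> = ?J r \<beta> Q \<tau>"
      "?J Q 0 Q \<beta> + ?J Q \<beta> Q \<tau> = ?J Q 0 Q \<tau>" "?J Q 0 Q \<tau> + ?J Q \<tau> Q T = ?J Q 0 Q T"
      using ord a_pos T by (auto intro!: right)
    have \<Delta>_eq: "\<Delta> y T P Q = ?J l \<beta> r \<beta> + ?J P \<tau> l \<tau> + ?J r \<tau> Q \<tau> - ?J l \<beta> l \<tau> + ?J r \<beta> r \<tau>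
        - ?J P \<tau> P T + ?J Q \<tau> Q T"
      unfolding \<Delta>_def
      by (simp add: algebra_simps
          i1(1)[folded eq_diff_eq] i2(1)[folded eq_diff_eq] i3(1)[folded eq_diff_eq]
          i1(2-4)[symmetric] i2(2-4)[symmetric] i3(2-4)[symmetric])
    have b1: "norm (?J l \<beta> r \<beta>) \<le> 2 * \<delta> * A * E"
    proof -
      have "norm (?J l \<beta> r \<beta>) \<le> (C * \<eta> powr (- \<gamma>)) * exp (- \<beta> * y) * (r - l)"
        using ord a_pos \<eta> by (intro horizontal_bound conjI near) (auto simp: D_def \<beta>_def l_def r_def)
      also have "\<dots> = C * (\<eta> powr (- \<gamma>) * exp (- \<beta> * y)) * (2 * \<eta>)"
        by (simp add: l_def r_def)
      also have "\<dots> = 2 * (\<eta> * y) * A * E"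
        unfolding pow by (simp add: A_def)
      finally show ?thesis
        using \<eta>(3) by simp
    qed
    \<comment> \<open>Every point at height \<open>\<tau>\<close> is at least \<delta> away from the
      tip, so no power of y is lost, and exp (- \<tau> * y) has the surplus decay exp (- \<delta> *
      y).\<close>
    have top: "norm (?J p \<tau> q \<tau>) \<le> A' * E"
      if "P \<le> p" "p \<le> q" "q \<le> Q" "q - p \<le> \<delta>" "X \<inter> {p..q} = {}" for p q
    proof -
      have "norm (?J p \<tau> q \<tau>) \<le> (C * \<delta> powr (- \<gamma>)) * exp (- \<tau> * y) * (q - p)"
        using that \<delta> a_pos b_pos
        by (intro horizontal_bound conjI near) (auto simp: D_def P_def Q_def \<tau>_def)
      also have "\<dots> \<le> (C * \<delta> powr (- \<gamma>)) * (1 / \<delta> * E) * \<delta>"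
        unfolding \<tau>_def E_def using that y \<gamma>_pos \<delta>(1) C
        by (intro mult_mono mult_left_mono exp_le_powr_times_exp) auto
      finally show ?thesis
        using \<delta>(1) by (simp add: A'_def)
    qed
    have side: "norm (?J p \<beta> p \<tau>) \<le> A * E" if "\<bar>p - x\<bar> = \<eta>" for p
    proof -
      have "p \<notin> X"
        using only[of p] that \<eta> by auto
      then have "norm (?J p \<beta> p \<tau>) \<le> (C * \<eta> powr (- \<gamma>)) * exp (- (y - 0) * \<beta>) / (y - 0)"
      proof (intro vertical_bound)
        fix t assume "\<beta> \<le> t" "t \<le> \<tau>"
        then have "norm (F (Complex p t)) \<le> C * \<eta> powr (- \<gamma>)"
          using \<eta> that \<open>p \<notin> X\<close> by (intro near) (auto simp: \<beta>_def \<tau>_def)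
        then show "norm (F (Complex p t)) \<le> C * \<eta> powr (- \<gamma>) * exp (0 * t)"
          by simp
      qed (use ord y C a_pos in auto)
      also have "\<dots> = C * (\<eta> powr (- \<gamma>) * exp (- \<beta> * y)) / y"
        by (simp add: mult.commute)
      also have "\<dots> = A * E"
        unfolding pow using y by (simp add: A_def)
      finally show ?thesis .
    qed
    \<comment> \<open>The 2 stems from y - 1 / 2 > 1 / 2, the factor exp (\<tau> / 2) from the
      growth of F at the lower end, and 1 / \<delta> from the surplus decay.\<close>
    have tail: "norm (?J p \<tau> p T) \<le> 2 * B * exp (\<tau> / 2) / \<delta> * E"
      if "B \<ge> 0" "p \<notin> X" "\<And>t. t \<ge> 0 \<Longrightarrow> norm (F (Complex p t)) \<le> B * exp (t / 2)" for B p
    proof -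
      have "norm (?J p \<tau> p T) \<le> B * exp (- (y - 1 / 2) * \<tau>) / (y - 1 / 2)"
        using that T y ord a_pos b_pos by (intro vertical_bound) auto
      also have "\<dots> \<le> B * exp (- (y - 1 / 2) * \<tau>) / (1 / 2)"
        using that y by (intro divide_left_mono) auto
      also have "\<dots> = 2 * B * exp (\<tau> / 2) * exp (- (b + \<delta>) * y)"
        by (simp add: \<tau>_def algebra_simps flip: exp_add)
      also have "\<dots> \<le> 2 * B * exp (\<tau> / 2) * (1 / \<delta> * E)"
        unfolding E_def using that y \<gamma>_pos \<delta>(1) by (intro mult_left_mono exp_le_powr_times_exp) auto
      finally show ?thesis by simp
    qed
    have "norm (\<Delta> y T P Q) \<le> 2 * \<delta> * A * E + A' * E + A' * E + A * E + A * E
        + 2 * BP * exp (\<tau> / 2) / \<delta> * E + 2 * BQ * exp (\<tau> / 2) / \<delta> * E"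
      unfolding \<Delta>_eq
      by (intro norm_triangle_mono norm_triangle_le_diff[OF add_mono] b1 top side tail)
         (use l r ord \<eta> BP BQ \<open>X \<inter> {P..P} = {}\<close> \<open>X \<inter> {Q..Q} = {}\<close> in \<open>auto simp: P_def Q_def l_def r_def\<close>)
    then show ?thesis
      by (simp add: K_def E_def algebra_simps)
  qed
  then have "decaying P Q"
    unfolding decaying_def by blast
  moreover have "X \<inter> {x-\<delta>..x+\<delta>} = {x}"
    using only x \<delta>(1) by force
  ultimately show ?thesis
    using \<delta> by (auto simp: P_def Q_def)
qed

text \<open>Induction on the number of cuts over the interval: the column around one cut is taken
  out, and each of the two remaining intervals misses that cut.\<close>

lemma decaying_interval:
  assumes "p \<le> q" "p \<notin> X" "q \<notin> X"
  shows "decaying p q"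
  using assms
proof (induction "card (X \<inter> {p..q})" arbitrary: p q rule: less_induct)
  case less
  show ?case
  proof (cases "X \<inter> {p..q} = {}")
    case True
    then show ?thesis
      using decaying_gap less.prems by blast
  next
    case False
    then obtain x where x: "x \<in> X" "p \<le> x" "x \<le> q" by auto
    then have pq: "p < x" "x < q"
      using less.prems by (auto simp: order_le_less)
    obtain \<delta> where \<delta>: "0 < \<delta>" "\<delta> < min (x - p) (q - x)" "X \<inter> {x-\<delta>..x+\<delta>} = {x}" "decaying (x - \<delta>) (x + \<delta>)"
      using decaying_column[OF x(1), of "min (x - p) (q - x)"] pq by auto
    have ends: "x - \<delta> \<notin> X" "x + \<delta> \<notin> X"
      using \<delta>(1,3) by force+
    have smaller: "card (X \<inter> S) < card (X \<inter> {p..q})" if "S \<subseteq> {p..q}" "x \<notin> S" for S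
      using that x finite_X by (intro psubset_card_mono) auto
    have "decaying p (x - \<delta>)"
      using \<delta> x ends less.prems by (intro less.hyps smaller) auto
    moreover have "decaying (x + \<delta>) q"
      using \<delta> x ends less.prems by (intro less.hyps smaller) auto
    ultimately show ?thesis
      using decaying_trans \<delta>(4) by blast
  qed
qed

section \<open>Far vertical lines and convergence of the truncated integrals\<close>

lemma X_bounded: "\<exists>m>0. \<forall>x\<in>X. \<bar>x\<bar> < m"
proof -
  obtain m where "\<And>x. x \<in> X \<Longrightarrow> norm x \<le> m"
    using finite_imp_bounded[OF finite_X] by (auto simp: bounded_iff)
  then show ?thesis
    by (intro exI[of _ "\<bar>m\<bar> + 1"]) force
qed

text \<open>Inside the wedge F is small. Outside it |z| < R0 + (\<kappa> + 1) * Im z, and a large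
  |Re z| forces Im z to be large, so exp (Im z / 2) outweighs the polynomial growth even with the
  small factor \<epsilon>.\<close>

lemma far_bound:
  assumes "\<epsilon> > 0"
  shows "\<exists>R1. \<forall>z. \<bar>Re z\<bar> \<ge> R1 \<longrightarrow> Im z \<ge> 0 \<longrightarrow> Re z \<notin> X \<and> norm (F z) \<le> \<epsilon> * exp (Im z / 2)"
proof -
  obtain m where m: "\<And>x. x \<in> X \<Longrightarrow> \<bar>x\<bar> < m"
    using X_bounded by blast
  obtain \<kappa> R0 where \<kappa>: "\<kappa> > 0" and R0: "\<And>z. Im z > 0 \<Longrightarrow> \<bar>Re z\<bar> \<ge> R0 + \<kappa> * Im z \<Longrightarrow> norm (F z) \<le> \<epsilon>"
    using wedge assms by blast
  obtain C M q where q: "q > 0" and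
    C: "\<And>z. Im z \<ge> 0 \<Longrightarrow> Re z \<notin> X \<Longrightarrow> norm z \<ge> M \<Longrightarrow> norm (F z) \<le> C * (1 + norm z powr q)"
    using growth by blast
  have "((\<lambda>t. \<bar>C\<bar> * (1 + (R0 + (\<kappa> + 1) * t) powr q) * exp (- (t / 2))) \<longlongrightarrow> 0) at_top"
  proof -
    have "((\<lambda>t. (1 + (R0 + (\<kappa> + 1) * t) powr q) * exp (- (t / 2))) \<longlongrightarrow> 0) at_top"
      using q \<kappa> by real_asymp
    from tendsto_mult_left[OF this, of "\<bar>C\<bar>"] show ?thesis
      by (simp add: mult.assoc)
  qed
  then have "\<forall>\<^sub>F t in at_top. \<bar>C\<bar> * (1 + (R0 + (\<kappa> + 1) * t) powr q) * exp (- (t / 2)) < \<epsilon>"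
    using assms by (rule order_tendstoD)
  then obtain T1 where T1: "\<And>t. t \<ge> T1 \<Longrightarrow> \<bar>C\<bar> * (1 + (R0 + (\<kappa> + 1) * t) powr q) * exp (- (t / 2)) < \<epsilon>"
    unfolding eventually_at_top_linorder by blast
  \<comment> \<open>The three entries ensure, in this order, that Re z \<notin> X, that |z| \<ge> M,
    and that Im z > T1 outside the wedge.\<close>
  define R1 where "R1 = max m (max M (R0 + \<kappa> * T1))"
  have pos: "norm (F z) \<le> \<epsilon> * exp (Im z / 2)" if z: "\<bar>Re z\<bar> \<ge> R1" "Im z > 0" for z
  proof (cases "\<bar>Re z\<bar> \<ge> R0 + \<kappa> * Im z")
    case True
    have "\<epsilon> * 1 \<le> \<epsilon> * exp (Im z / 2)"
      using assms z by (intro mult_left_mono) auto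
    then show ?thesis
      using R0 True z by fastforce
  next
    case False
    have "\<kappa> * T1 < \<kappa> * Im z"
      using False z by (simp add: R1_def)
    then have t: "T1 < Im z"
      using \<kappa> by simp
    have "norm (F z) \<le> C * (1 + norm z powr q)"
      using z m[of "Re z"] abs_Re_le_cmod[of z] by (intro C) (auto simp: R1_def)
    also have "\<dots> \<le> \<bar>C\<bar> * (1 + norm z powr q)"
      by (intro mult_right_mono add_nonneg_nonneg) auto
    also have "\<dots> \<le> \<bar>C\<bar> * (1 + (R0 + (\<kappa> + 1) * Im z) powr q)"
      using q False z cmod_le[of z]
      by (intro mult_left_mono add_left_mono powr_mono2) (auto simp: algebra_simps)
    also have "\<dots> \<le> \<epsilon> * exp (Im z / 2)"
      using T1[of "Im z"] t by (simp add: exp_minus field_simps)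
    finally show ?thesis .
  qed
  have "norm (F z) \<le> \<epsilon> * exp (Im z / 2)" if z: "\<bar>Re z\<bar> \<ge> R1" "Im z \<ge> 0" for z
  proof (cases "Im z = 0")
    case True
    \<comment> \<open>The wedge bound concerns Im z > 0 only. On the real axis the estimate is the
      limit from above, along a segment that stays below the tips.\<close>
    have "continuous_on ((\<lambda>t. Complex (Re z) t) ` {0..b/2}) F"
      using holo a_pos b_pos
      by (auto intro!: continuous_on_subset[OF holomorphic_on_imp_continuous_on])
    then have "continuous_on {0..b/2} (\<lambda>t. F (Complex (Re z) t))"
      by (rule continuous_on_compose2) (auto intro!: continuous_intros)
    then have "((\<lambda>t. F (Complex (Re z) t)) \<longlongrightarrow> F (Complex (Re z) 0)) (at 0 within {0..b/2})"
      using b_pos by (auto simp: continuous_on_def)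
    then have lim: "((\<lambda>t. F (Complex (Re z) t)) \<longlongrightarrow> F (Complex (Re z) 0)) (at_right 0)"
      using b_pos by (simp add: at_within_Icc_at_right)
    have "norm (F (Complex (Re z) 0)) \<le> \<epsilon> * exp (0 / 2)"
    proof (rule tendsto_le[OF _ _ tendsto_norm[OF lim]])
      show "\<forall>\<^sub>F t in at_right 0. norm (F (Complex (Re z) t)) \<le> \<epsilon> * exp (t / 2)"
        using eventually_at_right_less[of "0::real"] by eventually_elim (use pos[of "Complex (Re z) _"] z in auto)
    qed (auto intro!: tendsto_eq_intros)
    then show ?thesis
      using True by (metis complex.collapse)
  qed (use pos z in auto)
  moreover have "Re z \<notin> X" if "\<bar>Re z\<bar> \<ge> R1" for z
    using m[of "Re z"] that by (auto simp: R1_def)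
  ultimately show ?thesis by blast
qed

lemma far_vertical:
  assumes "\<epsilon> > 0"
  shows "\<exists>R1. \<forall>y>1. \<forall>R. \<bar>R\<bar> \<ge> R1 \<longrightarrow> (\<forall>T\<ge>0. norm (J y (Complex R 0) (Complex R T)) \<le> \<epsilon>)"
proof -
  have "\<epsilon> / 2 > 0"
    using assms by simp
  then obtain R1 where R1: "\<And>z. \<bar>Re z\<bar> \<ge> R1 \<Longrightarrow> Im z \<ge> 0 \<Longrightarrow> Re z \<notin> X \<and> norm (F z) \<le> \<epsilon> / 2 * exp (Im z / 2)"
    using far_bound by blast
  have "norm (J y (Complex R 0) (Complex R T)) \<le> \<epsilon>" if "y > 1" "\<bar>R\<bar> \<ge> R1" "T \<ge> 0" for y R T
  proof -
    have "norm (J y (Complex R 0) (Complex R T)) \<le> \<epsilon> / 2 * exp (- (y - 1 / 2) * 0) / (y - 1 / 2)"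
      using that R1[of "Complex R _"] assms a_pos by (intro vertical_bound) fastforce+
    also have "\<dots> = \<epsilon> / 2 / (y - 1 / 2)"
      by simp
    also have "\<dots> \<le> \<epsilon> / 2 / (1 / 2)"
      using assms that by (intro divide_left_mono) auto
    finally show ?thesis by simp
  qed
  then show ?thesis by blast
qed

text \<open>The top side of the rectangle vanishes as T grows, leaving the two vertical sides. The
  bound does not involve the length q - p, which is what the Cauchy criterion for the truncated
  integrals requires.\<close>

lemma horizontal_far:
  assumes "X \<inter> {p..q} = {}" "p \<le> q" "y > 1"
    and "\<And>T. T \<ge> 0 \<Longrightarrow> norm (J y (Complex p 0) (Complex p T)) \<le> \<epsilon>"
    and "\<And>T. T \<ge> 0 \<Longrightarrow> norm (J y (Complex q 0) (Complex q T)) \<le> \<epsilon>"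
  shows "norm (J y (Complex p 0) (Complex q 0)) \<le> 2 * \<epsilon>"
proof -
  obtain B where B: "\<And>T. T \<ge> 0 \<Longrightarrow> norm (J y (Complex p T) (Complex q T)) \<le> B * exp (- T * (y - 1 / 2))"
    using gap_bound[OF assms(1,2)] by blast
  show ?thesis
  proof (rule le_of_exp_vanishing)
    fix T :: real assume T: "T \<ge> 0"
    have "J y (Complex p 0) (Complex q 0) = J y (Complex p 0) (Complex p T)
        - J y (Complex q 0) (Complex q T) + J y (Complex p T) (Complex q T)"
      using \<Delta>_gap[OF assms(1,2) T, of y] by (simp add: \<Delta>_def algebra_simps)
    also have "norm \<dots> \<le> \<epsilon> + \<epsilon> + B * exp (- T * (y - 1 / 2))"
      using assms B T by (intro norm_triangle_mono norm_triangle_le_diff add_mono) auto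
    finally show "norm (J y (Complex p 0) (Complex q 0)) \<le> 2 * \<epsilon> + B * exp (- T * (y - 1 / 2))"
      by simp
  qed (use assms in auto)
qed

lemma fourier_integral_bound:
  "\<exists>K. \<forall>y>1. \<exists>L. ((\<lambda>R. J y (Complex (- R) 0) (Complex R 0)) \<longlongrightarrow> L) at_top \<and>
     norm L \<le> K * (y powr (\<gamma> - 1) * exp (- b * y))"
proof -
  obtain P where P: "P > 0" "\<And>x. x \<in> X \<Longrightarrow> \<bar>x\<bar> < P"
    using X_bounded by blast
  have out: "X \<inter> {p..q} = {}" if "p \<ge> P \<or> q \<le> - P" for p q
    using that P(2) by force
  have "- P \<notin> X" "P \<notin> X"
    using P by force+
  then have "decaying (- P) P"
    using P(1) by (intro decaying_interval) auto
  then obtain K T0 where K: "\<And>y T. y > 1 \<Longrightarrow> T \<ge> T0 \<Longrightarrow>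
      norm (\<Delta> y T (- P) P) \<le> K * (y powr (\<gamma> - 1) * exp (- b * y))"
    unfolding decaying_def by blast
  have "\<exists>L. ((\<lambda>R. J y (Complex (- R) 0) (Complex R 0)) \<longlongrightarrow> L) at_top \<and>
     norm L \<le> K * (y powr (\<gamma> - 1) * exp (- b * y))" if y: "y > 1" for y
  proof -
    define g where "g = (\<lambda>R. J y (Complex (- R) 0) (Complex R 0))"
    define E where "E = K * (y powr (\<gamma> - 1) * exp (- b * y))"
    \<comment> \<open>The term 2 * \<epsilon> comes from the vertical sides over R and -R, the term
      4 * \<epsilon> from the two gaps between R and S and between -S and -R. The second estimate
      gives the existence of the limit, the first one its size.\<close>
    have key: "\<exists>R0. \<forall>R\<ge>R0. norm (g R) \<le> E + 2 * \<epsilon> \<and> (\<forall>S\<ge>R. norm (g S - g R) \<le> 4 * \<epsilon>)" if \<epsilon>: "\<epsilon> > 0" for \<epsilon>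
    proof -
      obtain R1 where R1: "\<And>R T. \<bar>R\<bar> \<ge> R1 \<Longrightarrow> T \<ge> 0 \<Longrightarrow> norm (J y (Complex R 0) (Complex R T)) \<le> \<epsilon>"
        using far_vertical[OF \<epsilon>] y by blast
      have "norm (g R) \<le> E + 2 * \<epsilon>" if R: "R \<ge> max P R1" for R
      proof -
        have gaps: "X \<inter> {-R..-P} = {}" "- R \<le> - P" "X \<inter> {P..R} = {}" "P \<le> R"
          using out R by auto
        obtain B1 where B1: "\<And>T. T \<ge> 0 \<Longrightarrow> norm (J y (Complex (-R) T) (Complex (-P) T)) \<le> B1 * exp (- T * (y - 1 / 2))"
          using gap_bound[OF gaps(1,2)] by blast
        obtain B2 where B2: "\<And>T. T \<ge> 0 \<Longrightarrow> norm (J y (Complex P T) (Complex R T)) \<le> B2 * exp (- T * (y - 1 / 2))"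
          using gap_bound[OF gaps(3,4)] by blast
        show ?thesis
        \<comment> \<open>\<open>B1\<close> and \<open>B2\<close> depend on R, so T tends to
          infinity while R stays fixed.\<close>
        proof (rule le_of_exp_vanishing)
          fix T assume "T \<ge> max 0 T0"
          then have T: "T \<ge> 0" "T \<ge> T0" by auto
          have "g R = \<Delta> y T (- R) R + J y (Complex (- R) 0) (Complex (- R) T) - J y (Complex R 0) (Complex R T)"
            by (simp add: g_def \<Delta>_def)
          also have "\<Delta> y T (- R) R = \<Delta> y T (- P) P + J y (Complex (-R) T) (Complex (-P) T) + J y (Complex P T) (Complex R T)"
            using \<Delta>_gap[OF gaps(1,2) T(1), of y] \<Delta>_gap[OF gaps(3,4) T(1), of y]
            by (simp flip: \<Delta>_add[of y T "-R" "-P" P] \<Delta>_add[of y T "-R" P R])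
          also have "norm (\<Delta> y T (- P) P + J y (Complex (-R) T) (Complex (-P) T) + J y (Complex P T) (Complex R T)
              + J y (Complex (- R) 0) (Complex (- R) T) - J y (Complex R 0) (Complex R T))
              \<le> E + B1 * exp (- T * (y - 1 / 2)) + B2 * exp (- T * (y - 1 / 2)) + \<epsilon> + \<epsilon>"
            using K[OF y T(2)] B1[OF T(1)] B2[OF T(1)] R1[of R T] R1[of "-R" T] R T(1)
            by (intro norm_triangle_le_diff add_mono norm_triangle_mono) (auto simp: E_def)
          finally show "norm (g R) \<le> E + 2 * \<epsilon> + (B1 + B2) * exp (- T * (y - 1 / 2))"
            by (simp add: algebra_simps)
        qed (use y in auto)
      qed
      moreover have "norm (g S - g R) \<le> 4 * \<epsilon>" if R: "R \<ge> max P R1" "S \<ge> R" for R S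
      proof -
        have "g S = J y (Complex (- S) 0) (Complex (- R) 0) + J y (Complex (- R) 0) (Complex S 0)"
          "J y (Complex (- R) 0) (Complex S 0) = g R + J y (Complex R 0) (Complex S 0)"
          unfolding g_def using a_pos b_pos by (simp_all add: J_triangle_bottom)
        then have "g S - g R = J y (Complex (- S) 0) (Complex (- R) 0) + J y (Complex R 0) (Complex S 0)"
          by simp
        also have "norm \<dots> \<le> 2 * \<epsilon> + 2 * \<epsilon>"
          using out R y R1 by (intro norm_triangle_mono horizontal_far) auto
        finally show ?thesis by simp
      qed
      ultimately show ?thesis by blast
    qed
    have "\<exists>L. (g \<longlongrightarrow> L) at_top"
    proof (rule convergent_at_top_Cauchy)
      fix e :: real assume "e > 0"
      then obtain R0 where R0: "\<And>R S. R \<ge> R0 \<Longrightarrow> S \<ge> R \<Longrightarrow> norm (g S - g R) \<le> 4 * (e / 8)"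
        using key[of "e / 8"] by auto
      have "dist (g R) (g S) < e" if "R \<ge> R0" "S \<ge> R0" for R S
        using R0[of R S] R0[of S R] that \<open>e > 0\<close>
        by (cases "R \<le> S") (auto simp: dist_norm norm_minus_commute)
      then show "\<exists>R0. \<forall>R\<ge>R0. \<forall>S\<ge>R0. dist (g R) (g S) < e" by blast
    qed
    then obtain L where L: "(g \<longlongrightarrow> L) at_top" by blast
    have "norm L \<le> E + \<epsilon>" if "\<epsilon> > 0" for \<epsilon>
    proof -
      have "\<epsilon> / 2 > 0"
        using that by simp
      from key[OF this] obtain R0 where R0: "\<And>R. R \<ge> R0 \<Longrightarrow> norm (g R) \<le> E + 2 * (\<epsilon> / 2)"
        by blast
      have "\<forall>\<^sub>F R in at_top. norm (g R) \<le> E + \<epsilon>"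
        using eventually_ge_at_top[of R0] by eventually_elim (use R0 in auto)
      then show ?thesis
        using tendsto_upperbound[OF tendsto_norm[OF L]] by auto
    qed
    then have "norm L \<le> E"
      by (rule field_le_epsilon)
    then show ?thesis
      using L unfolding g_def E_def by blast
  qed
  then show ?thesis by blast
qed

end

subsection \<open>Behaviour near branch points\<close>

text \<open>Since the sign is always 1 or -1, each removed ray is described by one inequality on the
  vertical line through its tip; its strictness accounts for the removal of the tip itself.\<close>

lemma mem_slit_plane:
  "z \<in> slit_plane U \<longleftrightarrow> (\<forall>v\<in>U. Re z = Re v \<longrightarrow> sgn_ge0 (Im v) * (Im z - Im v) < 0)"
proof -
  have sgn: "sgn_ge0 t * sgn_ge0 t = 1" "sgn_ge0 t \<noteq> 0" for t
    by (auto simp: sgn_ge0_def)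
  have cut: "z \<in> branch_cut v \<longleftrightarrow> Re z = Re v \<and> sgn_ge0 (Im v) * (Im z - Im v) > 0" for v
  proof
    assume "z \<in> branch_cut v"
    then obtain t where "t > 0" "z = v + of_real (sgn_ge0 (Im v)) * \<i> * of_real t"
      by (auto simp: branch_cut_def half_line_def)
    then show "Re z = Re v \<and> sgn_ge0 (Im v) * (Im z - Im v) > 0"
      using sgn by (simp flip: mult.assoc)
  next
    assume *: "Re z = Re v \<and> sgn_ge0 (Im v) * (Im z - Im v) > 0"
    have "z = v + of_real (sgn_ge0 (Im v)) * cis (pi / 2) * of_real (sgn_ge0 (Im v) * (Im z - Im v))"
      using * by (auto simp: complex_eq_iff sgn simp flip: mult.assoc)
    then show "z \<in> branch_cut v"
      unfolding branch_cut_def half_line_def using * by blast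
  qed
  have "z \<noteq> v \<and> z \<notin> branch_cut v \<longleftrightarrow> (Re z = Re v \<longrightarrow> sgn_ge0 (Im v) * (Im z - Im v) < 0)" for v
    unfolding cut by (auto simp: complex_eq_iff sgn_ge0_def split: if_splits)
  then show ?thesis
    by (auto simp: slit_plane_def)
qed

lemma slit_plane_mono: "U \<subseteq> V \<Longrightarrow> slit_plane V \<subseteq> slit_plane U"
  by (auto simp: slit_plane_def)

lemma open_slit_plane:
  assumes "finite U"
  shows "open (slit_plane U)"
proof -
  have "slit_plane U = (\<Inter>v\<in>U. - {z. Re z = Re v \<and> 0 \<le> sgn_ge0 (Im v) * (Im z - Im v)})"
    by (fastforce simp: mem_slit_plane not_le)
  also have "open \<dots>"
    using assms
    by (intro open_INT ballI open_Compl closed_Collect_conj closed_Collect_eq closed_Collect_le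
        continuous_intros) auto
  finally show ?thesis .
qed

text \<open>With s the sign at \<open>v\<close>, multiplication by \<i> * s sends the direction \<i>
  * s of the cut to -1 and hence the cut with its tip to the nonpositive reals, where the principal
  logarithm has its own cut.\<close>

lemma slit_plane_eq_preimage:
  "slit_plane {v} = {z. \<i> * of_real (sgn_ge0 (Im v)) * (z - v) \<notin> \<real>\<^sub>\<le>\<^sub>0}"
  by (auto simp: mem_slit_plane complex_nonpos_Reals_iff sgn_ge0_def)

lemma connected_slit_plane: "connected (slit_plane {v})"
proof -
  define c where "c = \<i> * complex_of_real (sgn_ge0 (Im v))"
  have c: "c \<noteq> 0"
    by (auto simp: c_def sgn_ge0_def)
  have "\<real>\<^sub>\<le>\<^sub>0 = complex_of_real ` {..0}"
    by (auto simp: nonpos_Reals_def)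
  then have "connected (- \<real>\<^sub>\<le>\<^sub>0 :: complex set)"
    using starlike_imp_connected[OF starlike_slotted_complex_plane_left[of 0]] by simp
  then have "connected ((\<lambda>w. w / c + v) ` (- \<real>\<^sub>\<le>\<^sub>0))"
    using c by (intro connected_continuous_image continuous_intros) auto
  also have "(\<lambda>w. w / c + v) ` (- \<real>\<^sub>\<le>\<^sub>0) = slit_plane {v}"
    unfolding slit_plane_eq_preimage c_def[symmetric]
  proof (intro equalityI subsetI)
    fix z assume "z \<in> {z. c * (z - v) \<notin> \<real>\<^sub>\<le>\<^sub>0}"
    then show "z \<in> (\<lambda>w. w / c + v) ` (- \<real>\<^sub>\<le>\<^sub>0)"
      using c by (intro image_eqI[of _ _ "c * (z - v)"]) auto
  qed (use c in auto)
  finally show ?thesis .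
qed

text \<open>On the slit plane \<open>L\<close> differs from a rotated principal logarithm by a constant.\<close>

lemma log_branch_Im_bounded:
  assumes "log_branch v L"
  shows "\<exists>M. \<forall>z\<in>slit_plane {v}. \<bar>Im (L z)\<bar> \<le> M"
proof -
  let ?S = "slit_plane {v}"
  define c where "c = \<i> * complex_of_real (sgn_ge0 (Im v))"
  have c: "c \<noteq> 0"
    by (auto simp: c_def sgn_ge0_def)
  have S: "?S = {z. c * (z - v) \<notin> \<real>\<^sub>\<le>\<^sub>0}"
    unfolding c_def by (rule slit_plane_eq_preimage)
  have S0: "c * (z - v) \<noteq> 0" if "z \<in> ?S" for z
    using that unfolding S by (metis mem_Collect_eq nonpos_Reals_zero_I)
  define g where "g z = L z - Ln (c * (z - v))" for z
  have opn: "open ?S"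
    by (simp add: open_slit_plane)
  have g: "g holomorphic_on ?S"
    unfolding g_def[abs_def] using assms unfolding log_branch_def
    by (auto intro!: holomorphic_intros simp: S)
  have eg: "exp (g z) = 1 / c" if "z \<in> ?S" for z
    using that assms S0[OF that] by (simp add: g_def exp_diff log_branch_def)
  have d: "(g has_field_derivative 0) (at z)" if z: "z \<in> ?S" for z
  proof -
    have dg: "(g has_field_derivative deriv g z) (at z)"
      using holomorphic_derivI[OF g opn z] .
    have "((\<lambda>z. exp (g z)) has_field_derivative exp (g z) * deriv g z) (at z)"
      using dg by (auto intro!: derivative_eq_intros)
    moreover have "((\<lambda>z. exp (g z)) has_field_derivative 0) (at z)"
      using eg by (intro has_field_derivative_transform_within_open[OF DERIV_const opn z, of "1 / c"]) auto
    ultimately have "exp (g z) * deriv g z = 0"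
      by (rule DERIV_unique)
    then show ?thesis
      using dg by simp
  qed
  obtain k where k: "\<And>z. z \<in> ?S \<Longrightarrow> g z = k"
    using DERIV_zero_connected_constant[OF connected_slit_plane opn finite.emptyI
        holomorphic_on_imp_continuous_on[OF g]] d by (metis DiffE)
  have "\<bar>Im (L z)\<bar> \<le> pi + \<bar>Im k\<bar>" if z: "z \<in> ?S" for z
  proof -
    have "L z = Ln (c * (z - v)) + k"
      using k[OF z] by (simp add: g_def algebra_simps)
    then show ?thesis
      using mpi_less_Im_Ln[OF S0[OF z]] Im_Ln_le_pi[OF S0[OF z]] by auto
  qed
  then show ?thesis by blast
qed

lemma log_branch_Re:
  assumes "log_branch v L" "z \<in> slit_plane {v}"
  shows "z \<noteq> v" "Re (L z) = ln (norm (z - v))"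
proof -
  have e: "exp (L z) = z - v"
    using assms by (auto simp: log_branch_def)
  then show "z \<noteq> v"
    using exp_not_eq_zero[of "L z"] by auto
  have "exp (Re (L z)) = norm (z - v)"
    using e norm_exp_eq_Re by metis
  then show "Re (L z) = ln (norm (z - v))"
    by (metis ln_exp)
qed

text \<open>Complex valued although its values are real, so that it can be compared with complex
  functions in Landau notation.\<close>

definition sing :: "real \<Rightarrow> complex \<Rightarrow> complex \<Rightarrow> complex" where
  "sing \<gamma> v z = of_real (norm (z - v) powr (- \<gamma>))"

lemma norm_sing: "norm (sing \<gamma> v z) = norm (z - v) powr (- \<gamma>)"
  by (simp add: sing_def)

lemma eventually_near: "\<forall>\<^sub>F z in at v within S. z \<in> S \<and> 0 < norm (z - v) \<and> norm (z - v) < 1"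
  for v :: complex
  unfolding eventually_at by (intro exI[of _ 1]) (auto simp: dist_norm)

lemma sing_ge_1:
  fixes v z :: complex
  assumes "\<gamma> > 0" "0 < norm (z - v)" "norm (z - v) < 1"
  shows "1 \<le> norm (z - v) powr (- \<gamma>)"
  using powr_mono2'[of "- \<gamma>" "norm (z - v)" 1] assms by simp

lemma one_bigo_sing:
  assumes "\<gamma> > 0"
  shows "(\<lambda>_. 1) \<in> O[at v within S](sing \<gamma> v)"
proof (rule bigoI)
  show "\<forall>\<^sub>F z in at v within S. norm (1::complex) \<le> 1 * norm (sing \<gamma> v z)"
    using eventually_near[where v = v and S = S] by eventually_elim (use sing_ge_1[OF assms] in \<open>simp add: norm_sing\<close>)
qed

lemma isCont_bigo_1:
  fixes G :: "complex \<Rightarrow> complex"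
  assumes "isCont G v"
  shows "G \<in> O[at v within S](\<lambda>_. 1)"
  using tendsto_within_subset[OF isContD[OF assms] subset_UNIV] by (intro bigoI_tendsto) auto

text \<open>The modulus of the power is |z - v| powr (- Re \<rho>) times exp (Im \<rho> * Im (L z)).
  The argument Im (L z) is bounded on the slit plane, so a complex order costs only a constant; for
  |z - v| < 1 the order may be raised to \<gamma>.\<close>

lemma branch_powr_bigo:
  assumes L: "log_branch v L" and S: "S \<subseteq> slit_plane {v}" and "Re \<rho> \<le> \<gamma>"
  shows "branch_powr L (- \<rho>) \<in> O[at v within S](sing \<gamma> v)"
proof -
  obtain M where M: "\<And>z. z \<in> slit_plane {v} \<Longrightarrow> \<bar>Im (L z)\<bar> \<le> M"
    using log_branch_Im_bounded[OF L] by blast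
  have "\<forall>\<^sub>F z in at v within S. norm (branch_powr L (- \<rho>) z) \<le> exp (\<bar>Im \<rho>\<bar> * M) * norm (sing \<gamma> v z)"
    using eventually_near[where v = v and S = S]
  proof eventually_elim
    case (elim z)
    then have z: "z \<in> slit_plane {v}"
      using S by blast
    have "norm (branch_powr L (- \<rho>) z) = exp (- Re \<rho> * ln (norm (z - v)) + Im \<rho> * Im (L z))"
      using log_branch_Re[OF L z] by (simp add: branch_powr_def norm_exp_eq_Re)
    also have "\<dots> \<le> exp (- \<gamma> * ln (norm (z - v)) + \<bar>Im \<rho>\<bar> * M)"
    proof -
      have "Im \<rho> * Im (L z) \<le> \<bar>Im \<rho>\<bar> * \<bar>Im (L z)\<bar>"
        by (simp flip: abs_mult)
      also have "\<dots> \<le> \<bar>Im \<rho>\<bar> * M"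
        using M[OF z] by (intro mult_left_mono) auto
      finally have "Im \<rho> * Im (L z) \<le> \<bar>Im \<rho>\<bar> * M" .
      moreover have "- Re \<rho> * ln (norm (z - v)) \<le> - \<gamma> * ln (norm (z - v))"
        using elim assms(3) by (intro mult_right_mono_neg) auto
      ultimately show ?thesis by simp
    qed
    also have "\<dots> = exp (\<bar>Im \<rho>\<bar> * M) * norm (sing \<gamma> v z)"
      using elim by (simp add: norm_sing powr_def flip: exp_add)
    finally show ?case .
  qed
  then show ?thesis by (rule bigoI)
qed

text \<open>As -\<rho> is a natural number the power is at most 1 near \<open>v\<close>. The
  logarithm is absorbed by any \<gamma> > 0: ln x \<le> x - 1 at x = t powr (- \<gamma>) yields -
  \<gamma> * ln t \<le> t powr (- \<gamma>).\<close>

lemma branch_powr_log_bigo: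
  assumes L: "log_branch v L" and S: "S \<subseteq> slit_plane {v}" and "- \<rho> \<in> \<nat>" "\<gamma> > 0"
  shows "(\<lambda>z. branch_powr L (- \<rho>) z * L z) \<in> O[at v within S](sing \<gamma> v)"
proof -
  obtain M where M: "\<And>z. z \<in> slit_plane {v} \<Longrightarrow> \<bar>Im (L z)\<bar> \<le> M"
    using log_branch_Im_bounded[OF L] by blast
  obtain k where k: "- \<rho> = of_nat k"
    using assms(3) by (auto elim: Nats_cases)
  have "\<forall>\<^sub>F z in at v within S. norm (branch_powr L (- \<rho>) z * L z) \<le> (1 / \<gamma> + \<bar>M\<bar>) * norm (sing \<gamma> v z)"
    using eventually_near[where v = v and S = S]
  proof eventually_elim
    case (elim z)
    then have z: "z \<in> slit_plane {v}"
      using S by blast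
    define t where "t = norm (z - v)"
    have t: "0 < t" "t < 1"
      using elim by (auto simp: t_def)
    have "norm (branch_powr L (- \<rho>) z) = exp (real k * ln t)"
      using log_branch_Re[OF L z] by (simp add: branch_powr_def norm_exp_eq_Re k t_def)
    also have "\<dots> \<le> 1"
      using t by (simp add: mult_nonneg_nonpos)
    finally have 1: "norm (branch_powr L (- \<rho>) z) \<le> 1" .
    have "- \<gamma> * ln t \<le> t powr (- \<gamma>)"
      using t ln_le_minus_one[of "t powr (- \<gamma>)"] by (simp add: ln_powr)
    then have "\<bar>ln t\<bar> \<le> 1 / \<gamma> * t powr (- \<gamma>)"
      using t assms(4) by (simp add: field_simps)
    moreover have "norm (L z) \<le> \<bar>ln t\<bar> + M"
      using cmod_le[of "L z"] log_branch_Re[OF L z] M[OF z] by (simp add: t_def)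
    moreover have "M \<le> \<bar>M\<bar> * t powr (- \<gamma>)"
      using mult_left_mono[OF sing_ge_1[OF assms(4)], of z v "\<bar>M\<bar>"] t by (simp add: t_def)
    ultimately have 2: "norm (L z) \<le> (1 / \<gamma> + \<bar>M\<bar>) * t powr (- \<gamma>)"
      by (simp add: algebra_simps)
    show ?case
      using mult_mono[OF 1 2] by (simp add: norm_mult norm_sing t_def)
  qed
  then show ?thesis by (rule bigoI)
qed

lemma branch_powr_holomorphic:
  assumes "log_branch v L"
  shows "branch_powr L s holomorphic_on slit_plane {v}"
  unfolding branch_powr_def[abs_def] using assms
  by (auto simp: log_branch_def intro!: holomorphic_intros)

lemma isCont_holomorphic_slit_plane:
  assumes "G holomorphic_on slit_plane U" "finite U" "v \<in> slit_plane U"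
  shows "isCont G v"
  using holomorphic_on_imp_continuous_on[OF assms(1)] open_slit_plane[OF assms(2)] assms(3)
  by (simp add: continuous_on_eq_continuous_at)

section \<open>The function Z with all its branch points\<close>

context
  fixes Z :: "complex \<Rightarrow> complex" and N :: nat and u \<rho> :: "nat \<Rightarrow> complex"
    and lg :: "nat \<Rightarrow> complex \<Rightarrow> complex"
  assumes inj: "inj_on u {1..N}"
    and lg: "\<And>n. n \<in> {1..N} \<Longrightarrow> log_branch (u n) (lg n)"
    and Z: "alg_or_log_branch_points Z N u \<rho> lg"
begin

lemma branch_points_holomorphic: "Z holomorphic_on slit_plane (u ` {1..N})"
proof -
  obtain K G where K: "K \<subseteq> {1..N}" and G: "G holomorphic_on slit_plane (u ` K)" and
    eq: "\<And>z. z \<in> slit_plane (u ` {1..N}) \<Longrightarrow> Z z = G z * (\<Prod>n\<in>{1..N} - K. branch_powr (lg n) (- \<rho> n) z)"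
    using Z unfolding alg_or_log_branch_points_def by blast
  have "(\<lambda>z. G z * (\<Prod>n\<in>{1..N} - K. branch_powr (lg n) (- \<rho> n) z)) holomorphic_on slit_plane (u ` {1..N})"
  proof (intro holomorphic_intros)
    show "G holomorphic_on slit_plane (u ` {1..N})"
      using K by (intro holomorphic_on_subset[OF G] slit_plane_mono) auto
    fix n assume "n \<in> {1..N} - K"
    then show "branch_powr (lg n) (- \<rho> n) holomorphic_on slit_plane (u ` {1..N})"
      by (intro holomorphic_on_subset[OF branch_powr_holomorphic[OF lg]] slit_plane_mono) auto
  qed
  then show ?thesis
    by (rule holomorphic_transform) (simp add: eq)
qed

text \<open>\<open>v\<close> stands for the tip of a cut and may or may not be a branch point. It
  avoids the cuts of all branch points different from it, so their factors are continuous at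
  \<open>v\<close> and contribute O(1); at most one factor is singular there.\<close>

lemma branch_points_bigo:
  assumes v: "\<And>n. n \<in> {1..N} \<Longrightarrow> u n \<noteq> v \<Longrightarrow> v \<in> slit_plane {u n}"
    and \<rho>: "\<And>n. n \<in> {1..N} \<Longrightarrow> u n = v \<Longrightarrow> Re (\<rho> n) \<le> \<gamma>" and \<gamma>: "\<gamma> > 0"
  shows "Z \<in> O[at v within slit_plane (u ` {1..N})](sing \<gamma> v)"
proof -
  let ?S = "slit_plane (u ` {1..N})"
  let ?F = "at v within ?S"
  obtain K G where K: "K \<subseteq> {1..N}" and G: "G holomorphic_on slit_plane (u ` K)" and
    eq: "\<forall>z\<in>?S. Z z = G z * (\<Prod>n\<in>{1..N} - K. branch_powr (lg n) (- \<rho> n) z)" and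
    logs: "\<forall>n\<in>K. - \<rho> n \<in> \<nat> \<and> (\<exists>r>0. \<exists>g. g holomorphic_on ball (u n) r \<and>
              (\<forall>z \<in> ball (u n) r \<inter> ?S. Z z = branch_powr (lg n) (- \<rho> n) z * lg n z * g z))"
    using Z unfolding alg_or_log_branch_points_def by blast
  have sub: "?S \<subseteq> slit_plane {u n}" if "n \<in> {1..N}" for n
    using that by (intro slit_plane_mono) auto
  show ?thesis
  proof (cases "v \<in> u ` K")
    case True
    then obtain n where n: "n \<in> K" "u n = v" by blast
    then have nN: "n \<in> {1..N}" using K by blast
    have logn: "- \<rho> n \<in> \<nat>"
      using logs n(1) by blast
    from logs n have "\<exists>r>0. \<exists>g. g holomorphic_on ball v r \<and>
        (\<forall>z \<in> ball v r \<inter> ?S. Z z = branch_powr (lg n) (- \<rho> n) z * lg n z * g z)"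
      by force
    then obtain r g where r: "r > 0" and g: "g holomorphic_on ball v r" and
      Zeq: "\<forall>z \<in> ball v r \<inter> ?S. Z z = branch_powr (lg n) (- \<rho> n) z * lg n z * g z"
      by blast
    have "isCont g v"
      using g r holomorphic_on_imp_continuous_on[OF g]
      by (simp add: continuous_on_eq_continuous_at)
    have b: "(\<lambda>z. branch_powr (lg n) (- \<rho> n) z * lg n z * g z) \<in> O[?F](\<lambda>z. sing \<gamma> v z * 1)"
      by (rule landau_o.big.mult[OF branch_powr_log_bigo isCont_bigo_1])
        (use lg[OF nN] sub[OF nN] logn \<gamma> n(2) \<open>isCont g v\<close> in simp_all)
    have ev: "\<forall>\<^sub>F z in ?F. Z z = branch_powr (lg n) (- \<rho> n) z * lg n z * g z"
      unfolding eventually_at using r Zeq by (intro exI[of _ r]) (auto simp: dist_commute)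
    show ?thesis
      using landau_o.big.in_cong[OF ev] b by (simp only: mult_1_right)
  next
    case False
    have vK: "v \<in> slit_plane (u ` K)"
    proof -
      have "v \<in> slit_plane {u n}" if "n \<in> K" for n
        using v[of n] K False that by blast
      then show ?thesis
        by (simp add: slit_plane_def)
    qed
    have G1: "G \<in> O[?F](\<lambda>_. 1)"
    proof -
      have "finite (u ` K)"
        using finite_subset[OF K] by simp
      then show ?thesis
        using isCont_holomorphic_slit_plane[OF G _ vK] by (intro isCont_bigo_1) simp
    qed
    define A where "A = {1..N} - K"
    have other: "branch_powr (lg n) (- \<rho> n) \<in> O[?F](\<lambda>_. 1)" if "n \<in> A" "u n \<noteq> v" for n
    proof -
      have nN: "n \<in> {1..N}"
        using that(1) by (simp add: A_def)
      show ?thesis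
        by (rule isCont_bigo_1, rule isCont_holomorphic_slit_plane[OF branch_powr_holomorphic[OF lg[OF nN]] _ v[OF nN that(2)]])
          simp
    qed
    have prod_other: "(\<lambda>z. \<Prod>n\<in>B. branch_powr (lg n) (- \<rho> n) z) \<in> O[?F](\<lambda>_. 1)"
      if "B \<subseteq> A" "\<And>n. n \<in> B \<Longrightarrow> u n \<noteq> v" for B
      using that other by (intro landau_o.big_prod_in_1) blast
    have "(\<lambda>z. \<Prod>n\<in>A. branch_powr (lg n) (- \<rho> n) z) \<in> O[?F](sing \<gamma> v)"
    proof (cases "\<exists>n\<in>A. u n = v")
      case True
      then obtain n where n: "n \<in> A" "u n = v" by blast
      then have nN: "n \<in> {1..N}" by (simp add: A_def)
      \<comment> \<open>Injectivity of \<open>u\<close> enters here: two factors singular at the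
        same point would add up their orders.\<close>
      have distinct: "u m \<noteq> v" if "m \<in> A - {n}" for m
      proof
        assume "u m = v"
        then have "m = n"
          using inj_onD[OF inj, of m n] that n by (simp add: A_def)
        then show False
          using that by simp
      qed
      have "branch_powr (lg n) (- \<rho> n) \<in> O[?F](sing \<gamma> v)"
        using lg[OF nN] sub[OF nN] \<rho>[OF nN] unfolding n(2) by (intro branch_powr_bigo) simp_all
      moreover have "(\<lambda>z. \<Prod>m\<in>A - {n}. branch_powr (lg m) (- \<rho> m) z) \<in> O[?F](\<lambda>_. 1)"
        by (rule prod_other) (use distinct in auto)
      ultimately have "(\<lambda>z. branch_powr (lg n) (- \<rho> n) z * (\<Prod>m\<in>A - {n}. branch_powr (lg m) (- \<rho> m) z))
          \<in> O[?F](\<lambda>z. sing \<gamma> v z * 1)"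
        by (rule landau_o.big.mult)
      moreover have "(\<lambda>z. \<Prod>m\<in>A. branch_powr (lg m) (- \<rho> m) z)
          = (\<lambda>z. branch_powr (lg n) (- \<rho> n) z * (\<Prod>m\<in>A - {n}. branch_powr (lg m) (- \<rho> m) z))"
        using n by (intro ext prod.remove) (auto simp: A_def)
      ultimately show ?thesis by (simp only: mult_1_right)
    next
      case False
      then have "(\<lambda>z. \<Prod>n\<in>A. branch_powr (lg n) (- \<rho> n) z) \<in> O[?F](\<lambda>_. 1)"
        by (intro prod_other) auto
      then show ?thesis
        by (rule landau_o.big_trans[OF _ one_bigo_sing[OF \<gamma>]])
    qed
    then have b: "(\<lambda>z. G z * (\<Prod>n\<in>A. branch_powr (lg n) (- \<rho> n) z)) \<in> O[?F](\<lambda>z. 1 * sing \<gamma> v z)"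
      by (intro landau_o.big.mult G1)
    have ev: "\<forall>\<^sub>F z in ?F. Z z = G z * (\<Prod>n\<in>A. branch_powr (lg n) (- \<rho> n) z)"
      using eventually_near by eventually_elim (simp add: eq A_def)
    show ?thesis
      using landau_o.big.in_cong[OF ev] b by (simp only: mult_1_left)
  qed
qed

end

text \<open>The starting point is real, where \<open>sgn_ge0\<close> is 1, so the half-line runs in
  direction cis \<theta>. The supremum is taken in \<open>ennreal\<close> and is therefore
  meaningful even when infinite; convergence to 0 makes it finite eventually.\<close>

lemma tendsto_SUP_half_line:
  fixes G :: "complex \<Rightarrow> real"
  assumes "((\<lambda>R. SUP z\<in>half_line (of_real (s * R)) \<theta>. ennreal (G z)) \<longlongrightarrow> 0) at_top" "e > 0"
  shows "\<exists>R0. \<forall>R\<ge>R0. \<forall>t>0. G (of_real (s * R) + cis \<theta> * of_real t) \<le> e"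
proof -
  have "\<forall>\<^sub>F R in at_top. (SUP z\<in>half_line (of_real (s * R)) \<theta>. ennreal (G z)) < ennreal e"
    using assms by (intro order_tendstoD) auto
  then obtain R0 where R0: "\<And>R. R \<ge> R0 \<Longrightarrow> (SUP z\<in>half_line (of_real (s * R)) \<theta>. ennreal (G z)) < ennreal e"
    unfolding eventually_at_top_linorder by blast
  have "G (of_real (s * R) + cis \<theta> * of_real t) \<le> e" if "R \<ge> R0" "t > 0" for R t
  proof -
    have "of_real (s * R) + cis \<theta> * of_real t \<in> half_line (of_real (s * R)) \<theta>"
      using that unfolding half_line_def by (auto simp: sgn_ge0_def intro!: exI[of _ t])
    then have "ennreal (G (of_real (s * R) + cis \<theta> * of_real t)) \<le> (SUP z\<in>half_line (of_real (s * R)) \<theta>. ennreal (G z))"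
      by (rule SUP_upper)
    also have "\<dots> \<le> ennreal e"
      using R0[OF that(1)] by simp
    finally show ?thesis
      using assms(2) by (simp add: ennreal_le_iff)
  qed
  then show ?thesis by blast
qed

subsection \<open>The two half planes\<close>

text \<open>The half-lines sweep out the wedge: for Re z \<ge> 0 the point z lies on the one
  starting at Re z - cot \<theta> * Im z, with parameter Im z / sin \<theta>, and symmetrically for
  Re z < 0. Hence \<kappa> = cot \<theta>, positive since \<theta> < pi / 2.\<close>

lemma wedge_decay:
  fixes hhat :: "complex \<Rightarrow> complex"
  assumes \<theta>: "0 < \<theta>" "\<theta> < pi / 2"
    and right: "((\<lambda>R. SUP z\<in>half_line (complex_of_real R) \<theta>.
                  ennreal (norm (hhat z) + norm (hhat (- z)))) \<longlongrightarrow> 0) at_top"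
    and left: "((\<lambda>R. SUP z\<in>half_line (complex_of_real (- R)) (pi - \<theta>).
                  ennreal (norm (hhat z) + norm (hhat (- z)))) \<longlongrightarrow> 0) at_top"
  shows "\<exists>\<kappa>>0. \<forall>e>0. \<exists>R0. \<forall>z. Im z > 0 \<longrightarrow> \<bar>Re z\<bar> \<ge> R0 + \<kappa> * Im z \<longrightarrow>
    norm (hhat z) + norm (hhat (- z)) \<le> e"
proof (rule exI[of _ "cos \<theta> / sin \<theta>"], intro conjI allI impI)
  have sin: "sin \<theta> > 0" and cos: "cos \<theta> > 0"
    using \<theta> sin_gt_zero[of \<theta>] cos_gt_zero_pi[of \<theta>] by auto
  then show "cos \<theta> / sin \<theta> > 0"
    by simp
  fix e :: real assume e: "e > 0"
  have "\<exists>R0. \<forall>R\<ge>R0. \<forall>t>0. norm (hhat (of_real (1 * R) + cis \<theta> * of_real t))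
      + norm (hhat (- (of_real (1 * R) + cis \<theta> * of_real t))) \<le> e"
    by (rule tendsto_SUP_half_line) (use right e in simp_all)
  then obtain R1 where R1: "\<And>R t. R \<ge> R1 \<Longrightarrow> t > 0 \<Longrightarrow>
      norm (hhat (of_real (1 * R) + cis \<theta> * of_real t))
      + norm (hhat (- (of_real (1 * R) + cis \<theta> * of_real t))) \<le> e"
    by blast
  have "\<exists>R0. \<forall>R\<ge>R0. \<forall>t>0. norm (hhat (of_real (- 1 * R) + cis (pi - \<theta>) * of_real t))
      + norm (hhat (- (of_real (- 1 * R) + cis (pi - \<theta>) * of_real t))) \<le> e"
    by (rule tendsto_SUP_half_line) (use left e in simp_all)
  then obtain R2 where R2: "\<And>R t. R \<ge> R2 \<Longrightarrow> t > 0 \<Longrightarrow>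
      norm (hhat (of_real (- 1 * R) + cis (pi - \<theta>) * of_real t))
      + norm (hhat (- (of_real (- 1 * R) + cis (pi - \<theta>) * of_real t))) \<le> e"
    by blast
  have "norm (hhat z) + norm (hhat (- z)) \<le> e"
    if z: "Im z > 0" "\<bar>Re z\<bar> \<ge> max R1 R2 + cos \<theta> / sin \<theta> * Im z" for z
  proof -
    have t: "Im z / sin \<theta> > 0"
      using z sin by simp
    show ?thesis
    proof (cases "Re z \<ge> 0")
      case True
      have "z = of_real (Re z - cos \<theta> / sin \<theta> * Im z) + cis \<theta> * of_real (Im z / sin \<theta>)"
        using sin by (simp add: complex_eq_iff)
      then show ?thesis
        using R1[OF _ t, of "Re z - cos \<theta> / sin \<theta> * Im z"] True z(2) by simp
    next
      case False
      have "z = of_real (- 1 * (- Re z - cos \<theta> / sin \<theta> * Im z)) + cis (pi - \<theta>) * of_real (Im z / sin \<theta>)"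
        using sin by (simp add: complex_eq_iff)
      then show ?thesis
        using R2[OF _ t, of "- Re z - cos \<theta> / sin \<theta> * Im z"] False z(2) by simp
    qed
  qed
  then show "\<exists>R0. \<forall>z. Im z > 0 \<longrightarrow> \<bar>Re z\<bar> \<ge> R0 + cos \<theta> / sin \<theta> * Im z \<longrightarrow>
      norm (hhat z) + norm (hhat (- z)) \<le> e"
    by blast
qed

text \<open>Symmetric truncation is invariant under x \<mapsto> -x, which turns a negative argument
  into a positive one. \<open>\<phi>\<close> and \<open>g\<close> are kept apart because
  \<open>fourier h\<close> and its extension are only known to agree on the real line.\<close>

lemma inv_fourier_trunc_eq_contour_integral:
  fixes g :: "complex \<Rightarrow> complex"
  assumes s: "s = 1 \<or> s = - 1" and g: "\<And>x. g (of_real x) = \<phi> (of_real x)"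
    and cont: "continuous_on UNIV (\<lambda>x::real. g (of_real x))" and R: "R > 0"
  shows "inv_fourier_trunc \<phi> (s * y) R = of_real (1 / (2 * pi)) *
    contour_integral (linepath (Complex (- R) 0) (Complex R 0)) (\<lambda>z. g (of_real s * z) * exp (\<i> * z * of_real y))"
proof -
  define k where "k x = g (of_real x) * exp (\<i> * of_real (x * (s * y)))" for x :: real
  have "continuous_on {-R..R} k"
    unfolding k_def[abs_def] by (intro continuous_intros continuous_on_subset[OF cont]) auto
  then have "set_integrable lborel {-R..R} k"
    by (rule borel_integrable_atLeastAtMost')
  then have "(LINT x:{-R..R}|lborel. k x) = integral {-R..R} k"
    by (rule set_borel_integral_eq_integral)
  also have "\<dots> = integral {-R..R} (\<lambda>x. k (s * x))"
    using s Henstock_Kurzweil_Integration.integral_reflect_real[of R "- R" k] by auto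
  also have "\<dots> = integral {-R..R} (\<lambda>x. g (of_real s * of_real x) * exp (\<i> * of_real x * of_real y))"
    using s by (auto simp: k_def mult.assoc)
  also have "\<dots> = contour_integral (linepath (of_real (- R)) (of_real R))
      (\<lambda>z. g (of_real s * z) * exp (\<i> * z * of_real y))"
    using R by (subst contour_integral_linepath_Reals_eq) auto
  finally show ?thesis
    by (simp only: inv_fourier_trunc_def k_def g complex_of_real_def[symmetric])
qed

text \<open>Multiplication by s = -1 is a rotation by pi: it keeps cuts vertical and exchanges those
  above with those below. Stating all hypotheses on branch points in terms of
  \<open>s * Im (u n)\<close> covers both half planes at once.\<close>

lemma inv_fourier_half_plane_bound:
  fixes h :: "real \<Rightarrow> real" and hhat Z H :: "complex \<Rightarrow> complex" and N :: nat
    and u \<rho> :: "nat \<Rightarrow> complex" and lg :: "nat \<Rightarrow> complex \<Rightarrow> complex" and a b \<gamma> s :: real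
  assumes s: "s = 1 \<or> s = - 1"
    and inj: "inj_on u {1..N}"
    and nonreal: "\<And>n. n \<in> {1..N} \<Longrightarrow> Im (u n) \<noteq> 0"
    and lg: "\<And>n. n \<in> {1..N} \<Longrightarrow> log_branch (u n) (lg n)"
    and Z: "alg_or_log_branch_points Z N u \<rho> lg"
    and H: "H holomorphic_on UNIV"
    and real: "\<And>x::real. hhat (of_real x) = fourier h (of_real x)"
    and hhat: "\<And>z. z \<in> slit_plane (u ` {1..N}) \<Longrightarrow> hhat z = Z z + H z"
    and growth: "\<exists>C>0. \<exists>q>0. \<forall>\<^sub>F z in at_infinity.
              z \<in> slit_plane (u ` {1..N}) \<longrightarrow> norm (hhat z) \<le> C * (1 + norm z powr q)"
    and wedge: "\<exists>\<kappa>>0. \<forall>e>0. \<exists>R0. \<forall>z. Im z > 0 \<longrightarrow> \<bar>Re z\<bar> \<ge> R0 + \<kappa> * Im z \<longrightarrow>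
      norm (hhat z) + norm (hhat (- z)) \<le> e"
    and pos: "a > 0" "b > 0" "\<gamma> > 0"
    and above: "\<And>n. n \<in> {1..N} \<Longrightarrow> s * Im (u n) > 0 \<Longrightarrow>
          s * Im (u n) \<ge> b \<and> (s * Im (u n) = b \<longrightarrow> Re (\<rho> n) \<le> \<gamma>)"
    and below: "\<And>n. n \<in> {1..N} \<Longrightarrow> s * Im (u n) < 0 \<Longrightarrow> s * Im (u n) \<le> - a"
  shows "\<exists>K. \<forall>y>1. (inv_fourier_trunc (fourier h) (s * y) \<longlongrightarrow> inv_fourier (fourier h) (s * y)) at_top \<and>
     norm (inv_fourier (fourier h) (s * y)) \<le> K * (y powr (\<gamma> - 1) * exp (- b * y))"
proof -
  let ?S = "slit_plane (u ` {1..N})"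
  define X where "X = (\<lambda>n. s * Re (u n)) ` {n\<in>{1..N}. s * Im (u n) > 0}"
  have XI: "s * Re (u n) \<in> X" if "n \<in> {1..N}" "s * Im (u n) > 0" for n
    using that by (auto simp: X_def)
  have ss: "s * s = 1"
    using s by auto
  have cases: "sgn_ge0 (Im (u n)) = s \<and> b \<le> s * Im (u n) \<or> sgn_ge0 (Im (u n)) = - s \<and> s * Im (u n) \<le> - a"
    if "n \<in> {1..N}" for n
    using nonreal[OF that] above[OF that] below[OF that] s by (auto simp: sgn_ge0_def)
  \<comment> \<open>After the rotation the cuts above start at height b or higher, those below at
    height -a or lower; so the domain of the locale is carried into the slit plane.\<close>
  have S: "of_real s * z \<in> ?S" if z: "- a < Im z" "Re z \<in> X \<longrightarrow> Im z < b" for z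
    unfolding mem_slit_plane
  proof safe
    fix n assume n: "n \<in> {1..N}" and re: "Re (of_real s * z) = Re (u n)"
    have sz: "s * Re (u n) = Re z"
      using re ss by (simp flip: re mult.assoc)
    from cases[OF n] show "sgn_ge0 (Im (u n)) * (Im (of_real s * z) - Im (u n)) < 0"
    proof
      assume *: "sgn_ge0 (Im (u n)) = s \<and> b \<le> s * Im (u n)"
      then have "Im z < b"
        using XI[OF n] sz z(2) pos(2) by simp
      then show ?thesis
        using * ss by (simp add: right_diff_distrib flip: mult.assoc)
    next
      assume *: "sgn_ge0 (Im (u n)) = - s \<and> s * Im (u n) \<le> - a"
      then show ?thesis
        using z(1) ss by (simp add: right_diff_distrib flip: mult.assoc)
    qed
  qed
  have hol: "hhat holomorphic_on ?S"
  proof (rule holomorphic_transform)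
    show "(\<lambda>z. Z z + H z) holomorphic_on ?S"
      by (intro holomorphic_on_add branch_points_holomorphic[OF inj lg Z] holomorphic_on_subset[OF H] subset_UNIV)
  qed (use hhat in simp)
  interpret slit_half_plane "\<lambda>z. hhat (of_real s * z)" X a b \<gamma>
  proof
    show "finite X"
      by (simp add: X_def)
    have "(hhat \<circ> (\<lambda>z. of_real s * z)) holomorphic_on {z. - a < Im z \<and> (Re z \<in> X \<longrightarrow> Im z < b)}"
      by (rule holomorphic_on_compose_gen[OF _ hol]) (auto intro!: holomorphic_intros S simp del: One_nat_def)
    then show "(\<lambda>z. hhat (of_real s * z)) holomorphic_on {z. - a < Im z \<and> (Re z \<in> X \<longrightarrow> Im z < b)}"
      by (simp add: o_def)
    fix x assume "x \<in> X"
    define v where "v = of_real s * Complex x b"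
    have sv: "s * Re v = x" "s * Im v = b"
      using ss by (simp_all add: v_def flip: mult.assoc)
    have 1: "v \<in> slit_plane {u n}" if n: "n \<in> {1..N}" "u n \<noteq> v" for n
    proof -
      have "sgn_ge0 (Im (u n)) * (Im v - Im (u n)) < 0" if re: "Re v = Re (u n)"
        using cases[OF n(1)]
      proof
        assume *: "sgn_ge0 (Im (u n)) = s \<and> b \<le> s * Im (u n)"
        \<comment> \<open>A branch point with the abscissa and the height of \<open>v\<close> would
          be \<open>v\<close> itself; hence the other ones on this line lie strictly higher and
          their cuts miss \<open>v\<close>.\<close>
        have "s * Im (u n) \<noteq> b"
          using n(2) sv(2) re s by (auto simp: complex_eq_iff)
        then show ?thesis
          using * sv(2) by (simp add: right_diff_distrib)
      next
        assume *: "sgn_ge0 (Im (u n)) = - s \<and> s * Im (u n) \<le> - a"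
        then show ?thesis
          using pos sv(2) by (simp add: right_diff_distrib)
      qed
      then show ?thesis
        by (simp add: mem_slit_plane)
    qed
    have 2: "Re (\<rho> n) \<le> \<gamma>" if n: "n \<in> {1..N}" "u n = v" for n
      using above[OF n(1)] sv(2) pos(2) unfolding n(2) by simp
    have "Z \<in> O[at v within ?S](sing \<gamma> v)"
      by (rule branch_points_bigo[OF inj lg Z 1 2 pos(3)])
    moreover have "H \<in> O[at v within ?S](sing \<gamma> v)"
    proof (rule landau_o.big_trans[OF isCont_bigo_1 one_bigo_sing[OF pos(3)]])
      show "isCont H v"
        using holomorphic_on_imp_continuous_on[OF H] by (simp add: continuous_on_eq_continuous_at)
    qed
    ultimately have "(\<lambda>z. Z z + H z) \<in> O[at v within ?S](sing \<gamma> v)"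
      by (rule sum_in_bigo)
    then obtain C where "\<forall>\<^sub>F z in at v within ?S. norm (Z z + H z) \<le> C * norm (sing \<gamma> v z)"
      by (rule landau_o.bigE)
    then obtain d where d: "d > 0" and
      C: "\<And>z. z \<in> ?S \<Longrightarrow> z \<noteq> v \<Longrightarrow> dist z v < d \<Longrightarrow> norm (Z z + H z) \<le> C * norm (z - v) powr (- \<gamma>)"
      unfolding eventually_at norm_sing by blast
    \<comment> \<open>The radius is capped by b so that Im z > 0, away from the cuts below.\<close>
    have "norm (hhat (of_real s * z)) \<le> C * norm (z - Complex x b) powr (- \<gamma>)"
      if z: "norm (z - Complex x b) < min d b" "Re z \<in> X \<longrightarrow> Im z < b" for z
    proof -
      have n: "norm (of_real s * z - v) = norm (z - Complex x b)"
        using s by (auto simp: v_def norm_mult simp flip: right_diff_distrib)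
      have "Im z > 0"
        using z(1) abs_Im_le_cmod[of "z - Complex x b"] by auto
      then have zS: "of_real s * z \<in> ?S"
        using S z(2) pos(1) by auto
      have "z \<noteq> Complex x b"
        using z(2) \<open>x \<in> X\<close> by auto
      then have "of_real s * z \<noteq> v"
        using n by auto
      then show ?thesis
        using C[OF zS] z(1) n hhat[OF zS] by (simp add: dist_norm)
    qed
    then show "\<exists>C r. r > 0 \<and> (\<forall>z. norm (z - Complex x b) < r \<longrightarrow> (Re z \<in> X \<longrightarrow> Im z < b) \<longrightarrow>
         norm (hhat (of_real s * z)) \<le> C * norm (z - Complex x b) powr (- \<gamma>))"
      using d pos(2) by (intro exI[of _ C] exI[of _ "min d b"]) auto
  next
    obtain C q M where C: "q > 0" "\<And>z. norm z \<ge> M \<Longrightarrow> z \<in> ?S \<Longrightarrow> norm (hhat z) \<le> C * (1 + norm z powr q)"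
      using growth unfolding eventually_at_infinity by blast
    have ns: "norm (of_real s * z) = norm z" for z :: complex
      using s by (auto simp: norm_mult)
    have "norm (hhat (of_real s * z)) \<le> C * (1 + norm z powr q)"
      if "Im z \<ge> 0" "Re z \<notin> X" "norm z \<ge> M" for z
      using C(2)[of "of_real s * z"] S[of z] that pos(1) by (simp add: ns)
    then show "\<exists>C M q. q > 0 \<and> (\<forall>z. Im z \<ge> 0 \<longrightarrow> Re z \<notin> X \<longrightarrow> norm z \<ge> M \<longrightarrow>
        norm (hhat (of_real s * z)) \<le> C * (1 + norm z powr q))"
      using C(1) by blast
  next
    have le: "norm (hhat (of_real s * z)) \<le> norm (hhat z) + norm (hhat (- z))" for z
      using s by auto
    show "\<exists>\<kappa>>0. \<forall>e>0. \<exists>R0. \<forall>z. Im z > 0 \<longrightarrow> \<bar>Re z\<bar> \<ge> R0 + \<kappa> * Im z \<longrightarrow>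
        norm (hhat (of_real s * z)) \<le> e"
      using wedge le order_trans by meson
  qed (use pos in auto)
  have "of_real x \<in> ?S" for x :: real
    using S[of "of_real (s * x)"] pos ss by (simp flip: mult.assoc of_real_mult)
  then have cont: "continuous_on UNIV (\<lambda>x::real. hhat (of_real x))"
    by (intro continuous_on_compose2[OF holomorphic_on_imp_continuous_on[OF hol]] continuous_intros) auto
  obtain K where K: "\<And>y. y > 1 \<Longrightarrow> \<exists>L. ((\<lambda>R. J y (Complex (- R) 0) (Complex R 0)) \<longlongrightarrow> L) at_top \<and>
     norm L \<le> K * (y powr (\<gamma> - 1) * exp (- b * y))"
    using fourier_integral_bound by blast
  have "(inv_fourier_trunc (fourier h) (s * y) \<longlongrightarrow> inv_fourier (fourier h) (s * y)) at_top \<and>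
     norm (inv_fourier (fourier h) (s * y)) \<le> 1 / (2 * pi) * K * (y powr (\<gamma> - 1) * exp (- b * y))"
    if y: "y > 1" for y
  proof -
    obtain L where L: "((\<lambda>R. J y (Complex (- R) 0) (Complex R 0)) \<longlongrightarrow> L) at_top"
      and nL: "norm L \<le> K * (y powr (\<gamma> - 1) * exp (- b * y))"
      using K[OF y] by blast
    have "\<forall>\<^sub>F R in at_top. of_real (1 / (2 * pi)) * J y (Complex (- R) 0) (Complex R 0)
        = inv_fourier_trunc (fourier h) (s * y) R"
      using eventually_gt_at_top[of 0]
    proof eventually_elim
      case (elim R)
      then show ?case
        using inv_fourier_trunc_eq_contour_integral[OF s real cont elim, of y] by (simp add: f_def[abs_def])
    qed
    from Lim_transform_eventually[OF tendsto_mult_left[OF L] this]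
    have lim: "(inv_fourier_trunc (fourier h) (s * y) \<longlongrightarrow> of_real (1 / (2 * pi)) * L) at_top" .
    then have eq: "inv_fourier (fourier h) (s * y) = of_real (1 / (2 * pi)) * L"
      unfolding inv_fourier_def by (intro tendsto_Lim) auto
    have "norm (of_real (1 / (2 * pi)) * L) = 1 / (2 * pi) * norm L"
      by (simp add: norm_mult norm_divide)
    also have "\<dots> \<le> 1 / (2 * pi) * (K * (y powr (\<gamma> - 1) * exp (- b * y)))"
      using nL by (intro mult_left_mono) auto
    finally show ?thesis
      using lim unfolding eq by (simp only: mult.assoc)
  qed
  then show ?thesis by blast
qed

theorem theorem3p8:
  fixes h :: "real \<Rightarrow> real"
    and hhat Z H :: "complex \<Rightarrow> complex"
    and N :: nat
    and u \<rho> :: "nat \<Rightarrow> complex"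
    and lg :: "nat \<Rightarrow> complex \<Rightarrow> complex"
    and a b \<gamma>p \<gamma>m :: real
  assumes "integrable lborel h"
    and "piecewise_C1 h"
    and "inj_on u {1..N}"
    and "\<And>n. n \<in> {1..N} \<Longrightarrow> u n \<notin> \<real>"
    and "\<And>n. n \<in> {1..N} \<Longrightarrow> \<rho> n \<noteq> 0"
    and "\<And>n. n \<in> {1..N} \<Longrightarrow> log_branch (u n) (lg n)"
    and "alg_or_log_branch_points Z N u \<rho> lg"
    and "H holomorphic_on UNIV"
    and "\<And>x::real. hhat (complex_of_real x) = fourier h (complex_of_real x)"
    and "\<And>z. z \<in> slit_plane (u ` {1..N}) \<Longrightarrow> hhat z = Z z + H z"
    and i: "\<exists>C>0. \<exists>q>0. \<forall>\<^sub>F z in at_infinity.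
              z \<in> slit_plane (u ` {1..N}) \<longrightarrow> norm (hhat z) \<le> C * (1 + norm z powr q)"
    and ii: "\<exists>\<theta>. 0 < \<theta> \<and> \<theta> < pi / 2 \<and>
          ((\<lambda>R. SUP z\<in>half_line (complex_of_real R) \<theta>.
                  ennreal (norm (hhat z) + norm (hhat (- z)))) \<longlongrightarrow> 0) at_top \<and>
          ((\<lambda>R. SUP z\<in>half_line (complex_of_real (- R)) (pi - \<theta>).
                  ennreal (norm (hhat z) + norm (hhat (- z)))) \<longlongrightarrow> 0) at_top"
    and iii: "a > 0" "b > 0" "\<gamma>p > 0" "\<gamma>m > 0"
      "\<And>n. n \<in> {1..N} \<Longrightarrow> Im (u n) > 0 \<Longrightarrow>
          Im (u n) \<ge> b \<and> (Im (u n) = b \<longrightarrow> Re (\<rho> n) \<le> \<gamma>p)"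
      "\<And>n. n \<in> {1..N} \<Longrightarrow> Im (u n) < 0 \<Longrightarrow>
          Im (u n) \<le> - a \<and> (Im (u n) = - a \<longrightarrow> Re (\<rho> n) \<le> \<gamma>m)"
  shows "\<exists>Cp>0. \<exists>Cm>0.
     (\<forall>y>1. (inv_fourier_trunc (fourier h) y \<longlongrightarrow> inv_fourier (fourier h) y) at_top \<and>
        norm (inv_fourier (fourier h) y) \<le> Cp * y powr (\<gamma>p - 1) * exp (- b * y)) \<and>
     (\<forall>y < - 1. (inv_fourier_trunc (fourier h) y \<longlongrightarrow> inv_fourier (fourier h) y) at_top \<and>
        norm (inv_fourier (fourier h) y) \<le> Cm * \<bar>y\<bar> powr (\<gamma>m - 1) * exp (- a * \<bar>y\<bar>))"
proof -
  have nonreal: "Im (u n) \<noteq> 0" if "n \<in> {1..N}" for n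
    using assms(4)[OF that] complex_is_Real_iff by blast
  have wedge: "\<exists>\<kappa>>0. \<forall>e>0. \<exists>R0. \<forall>z. Im z > 0 \<longrightarrow> \<bar>Re z\<bar> \<ge> R0 + \<kappa> * Im z \<longrightarrow>
      norm (hhat z) + norm (hhat (- z)) \<le> e"
    using ii wedge_decay by blast
  note bound = inv_fourier_half_plane_bound[where u = u and \<rho> = \<rho> and lg = lg and Z = Z
      and H = H and hhat = hhat and h = h and N = N]
  have above_p: "1 * Im (u n) \<ge> b \<and> (1 * Im (u n) = b \<longrightarrow> Re (\<rho> n) \<le> \<gamma>p)"
    if "n \<in> {1..N}" "1 * Im (u n) > 0" for n
    using iii(5)[OF that(1)] that(2) by auto
  have below_p: "1 * Im (u n) \<le> - a" if "n \<in> {1..N}" "1 * Im (u n) < 0" for n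
    using iii(6)[OF that(1)] that(2) by auto
  have "\<exists>K. \<forall>y>1. (inv_fourier_trunc (fourier h) (1 * y) \<longlongrightarrow> inv_fourier (fourier h) (1 * y)) at_top \<and>
     norm (inv_fourier (fourier h) (1 * y)) \<le> K * (y powr (\<gamma>p - 1) * exp (- b * y))"
    by (rule bound[where a = a]; (fact | simp))
  then obtain Kp where Kp: "\<And>y. y > 1 \<Longrightarrow>
      (inv_fourier_trunc (fourier h) y \<longlongrightarrow> inv_fourier (fourier h) y) at_top \<and>
      norm (inv_fourier (fourier h) y) \<le> Kp * (y powr (\<gamma>p - 1) * exp (- b * y))"
    by auto
  \<comment> \<open>For s = -1 the constants swap: \<open>a\<close> becomes the height of the tips
    and \<open>b\<close> the margin below the real axis.\<close>
  have above_m: "- 1 * Im (u n) \<ge> a \<and> (- 1 * Im (u n) = a \<longrightarrow> Re (\<rho> n) \<le> \<gamma>m)"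
    if "n \<in> {1..N}" "- 1 * Im (u n) > 0" for n
    using iii(6)[OF that(1)] that(2) by auto
  have below_m: "- 1 * Im (u n) \<le> - b" if "n \<in> {1..N}" "- 1 * Im (u n) < 0" for n
    using iii(5)[OF that(1)] that(2) by auto
  have "\<exists>K. \<forall>y>1. (inv_fourier_trunc (fourier h) (- 1 * y) \<longlongrightarrow> inv_fourier (fourier h) (- 1 * y)) at_top \<and>
     norm (inv_fourier (fourier h) (- 1 * y)) \<le> K * (y powr (\<gamma>m - 1) * exp (- a * y))"
    by (rule bound[where a = b]; (fact | simp))
  then obtain Km where Km: "\<And>y. y > 1 \<Longrightarrow>
      (inv_fourier_trunc (fourier h) (- 1 * y) \<longlongrightarrow> inv_fourier (fourier h) (- 1 * y)) at_top \<and>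
      norm (inv_fourier (fourier h) (- 1 * y)) \<le> Km * (y powr (\<gamma>m - 1) * exp (- a * y))"
    by blast
  \<comment> \<open>Nothing is known about the sign of the constants obtained so far, whereas the
    claim asks for positive ones.\<close>
  have enlarge: "x \<le> (\<bar>K\<bar> + 1) * p * q" if "x \<le> K * (p * q)" "p \<ge> 0" "q \<ge> 0" for x K p q :: real
  proof -
    have "K * (p * q) \<le> (\<bar>K\<bar> + 1) * (p * q)"
      using that by (intro mult_right_mono) auto
    with that(1) show ?thesis
      by (simp add: mult.assoc)
  qed
  show ?thesis
  proof (rule exI[of _ "\<bar>Kp\<bar> + 1"], rule conjI, simp, rule exI[of _ "\<bar>Km\<bar> + 1"], intro conjI allI impI)
    fix y :: real assume "y > 1"
    then show "(inv_fourier_trunc (fourier h) y \<longlongrightarrow> inv_fourier (fourier h) y) at_top"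
      "norm (inv_fourier (fourier h) y) \<le> (\<bar>Kp\<bar> + 1) * y powr (\<gamma>p - 1) * exp (- b * y)"
      using Kp by (auto intro: enlarge)
  next
    fix y :: real assume y: "y < - 1"
    then show "(inv_fourier_trunc (fourier h) y \<longlongrightarrow> inv_fourier (fourier h) y) at_top"
      "norm (inv_fourier (fourier h) y) \<le> (\<bar>Km\<bar> + 1) * \<bar>y\<bar> powr (\<gamma>m - 1) * exp (- a * \<bar>y\<bar>)"
      using Km[of "- y"] by (auto intro!: enlarge)
  qed simp
qed

end
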